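(* Let $p>0$, $\beta>0$, $0\le\delta\le 1$, and $0<\varepsilon<\min(1-\delta,1/3)$. Consider an instance $(A,F,\mathrm{cost},k)$ of the $k$-median problem (so $\mathrm{cost}=\mathrm{dist}$) together with a set of centers $S^*=\{c^*_1,\ldots,c^*_k\}\subseteq F$ and its induced clustering $C^*=\{C^*_1,\ldots,C^*_k\}$ such that the instance is $(\beta,\delta)$-distribution stable with respect to $(C^*,S^* )$. Then there is an absolute constant $\eta$ and a neighborhood size $s=4\varepsilon^{-3}\beta^{-1}+O(\varepsilon^{-2}\beta^{-1})$ such that the solution $\mathcal{L}$ output by Local Search with neighborhood size $s$ and improvement threshold $\varepsilon$ satisfies $\mathrm{cost}(\mathcal{L})\le(1+\eta\varepsilon)\,\mathrm{cost}(C^* )$. Moreover, let $L=\{L_1,\ldots,L_k\}$ be the clusters of this output $\mathcal{L}$. If $\delta=0$, then there exists a bijection $\phi:L\to C^*$ such that for at least $m=k-O(\varepsilon^{-3}\beta^{-1})$ indices $i$ the following two statements hold: (i) at least a $(1-\varepsilon)$ fraction of the points of $\mathrm{IR}^{\varepsilon^2}_i\cap C^*_i$ are served in $\mathcal{L}$ by a single center $\mathcal{L}(i)$ of $\mathcal{L}$; (ii) the total number of clients $x\in\bigcup_{j\neq i}C^*_j$ served by $\mathcal{L}(i)$ in $\mathcal{L}$ is at most $\varepsilon\,|\mathrm{IR}^{\varepsilon^2}_i\cap C^*_i|$.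
   Context: $k$-clustering: $A$ (clients) and $F$ (candidate centers) lie in a metric space $(\mathcal{X},\mathrm{dist})$, $\mathrm{cost}:A\times F\to\mathbb{R}_+$, $k\ge 0$ an integer; one seeks $S\subseteq F$ with $|S|\le k$ minimizing $\mathrm{cost}(S)=\sum_{x\in A}\min_{c\in S}\mathrm{cost}(x,c)$. The clustering induced by $S$ assigns each client to its cheapest center of $S$ (ties broken arbitrarily); a client is "served" by that center. $k$-median is the case $\mathrm{cost}=\mathrm{dist}$. $\mathrm{OPT}$ denotes the optimal value, and $\mathrm{cost}(C^* )=\sum_i\sum_{x\in C^*_i}\mathrm{cost}(x,c^*_i)$. $(\beta,\delta)$-distribution stability: the pair $(A,F,\mathrm{cost},k),(C^*,S^* )$ is $(\beta,\delta)$-distribution stable if for every $i$ there is $\Delta_i\subseteq C^*_i$ with $|\Delta_i|\ge(1-\delta)|C^*_i|$ such that for every $x\in\Delta_i$ and every $j\ne i$, $\mathrm{cost}(x,c^*_j)\ge\beta\,\mathrm{OPT}/|C^*_j|$. Inner ring: for $\varepsilon_0>0$, $\mathrm{IR}^{\varepsilon_0}_i=\{x\in A\cup F:\mathrm{dist}(x,c^*_i)\le\varepsilon_0\beta\,\mathrm{OPT}/|C^*_i|\}$. Local Search with neighborhood size $s$ and threshold $\varepsilon$: start with an arbitrary $S\subseteq F$, $|S|\le k$; while there exists $S'\subseteq F$ with $|S'|\le k$, $|S\setminus S'|+|S'\setminus S|\le s$ and $\mathrm{cost}(S')\le(1-\varepsilon/n)\mathrm{cost}(S)$ (where $n=|A|$),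 set $S\gets S'$; output $S$.
   Formalization: In the moreover part the number of exceptional indices is O((cost(C* )/OPT)ε⁻³β⁻¹), as the claim fails for arbitrary S*; it is the stated bound for (near-)optimal S*. The error term in s is O(max(1, ε⁻²β⁻¹)), since s is an integer. *)

theory Defs
  imports "HOL-Analysis.Abstract_Metric_Spaces"
begin

section \<open>k-clustering\<close>

text \<open>A solution is nonempty: assigning clients to the empty set of centers would have infinite
  cost, and the minimum below is meaningful only for nonempty sets. The candidate set \<open>F\<close> may be
  infinite, so the optimal value is an infimum; it is the minimum when \<open>F\<close> is finite.\<close>

definition feasible :: "'a set \<Rightarrow> nat \<Rightarrow> 'a set \<Rightarrow> bool" where
  "feasible F k S \<longleftrightarrow> S \<subseteq> F \<and> finite S \<and> S \<noteq> {} \<and> card S \<le> k"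

definition sol_cost :: "('a \<Rightarrow> 'a \<Rightarrow> real) \<Rightarrow> 'a set \<Rightarrow> 'a set \<Rightarrow> real" where
  "sol_cost cost A S = (\<Sum>x\<in>A. Min ((\<lambda>c. cost x c) ` S))"

definition opt :: "('a \<Rightarrow> 'a \<Rightarrow> real) \<Rightarrow> 'a set \<Rightarrow> 'a set \<Rightarrow> nat \<Rightarrow> real" where
  "opt cost A F k = (INF S\<in>{S. feasible F k S}. sol_cost cost A S)"

definition clustering_cost ::
    "('a \<Rightarrow> 'a \<Rightarrow> real) \<Rightarrow> nat \<Rightarrow> (nat \<Rightarrow> 'a) \<Rightarrow> (nat \<Rightarrow> 'a set) \<Rightarrow> real" where
  "clustering_cost cost k c C = (\<Sum>i<k. \<Sum>x\<in>C i. cost x (c i))"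

text \<open>Ties may be broken arbitrarily, so both notions are relations: \<open>C\<close> is some clustering of \<open>A\<close>
  induced by the centers \<open>c 0, \<dots>, c (k - 1)\<close>, and \<open>\<sigma>\<close> is some assignment of every client to the
  center of \<open>S\<close> serving it.\<close>

definition induced_clustering ::
    "('a \<Rightarrow> 'a \<Rightarrow> real) \<Rightarrow> 'a set \<Rightarrow> nat \<Rightarrow> (nat \<Rightarrow> 'a) \<Rightarrow> (nat \<Rightarrow> 'a set) \<Rightarrow> bool" where
  "induced_clustering cost A k c C \<longleftrightarrow>
     (\<Union>i<k. C i) = A \<and> disjoint_family_on C {..<k} \<and>
     (\<forall>i<k. \<forall>x\<in>C i. \<forall>j<k. cost x (c i) \<le> cost x (c j))"

definition induced_assignment ::
    "('a \<Rightarrow> 'a \<Rightarrow> real) \<Rightarrow> 'a set \<Rightarrow> 'a set \<Rightarrow> ('a \<Rightarrow> 'a) \<Rightarrow> bool" where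
  "induced_assignment cost A S \<sigma> \<longleftrightarrow>
     (\<forall>x\<in>A. \<sigma> x \<in> S \<and> (\<forall>c\<in>S. cost x (\<sigma> x) \<le> cost x c))"

section \<open>Distribution stability\<close>

text \<open>Both definitions divide by cluster sizes and are meant for nonempty clusters only.\<close>

definition distribution_stable ::
    "real \<Rightarrow> real \<Rightarrow> ('a \<Rightarrow> 'a \<Rightarrow> real) \<Rightarrow> 'a set \<Rightarrow> 'a set \<Rightarrow> nat \<Rightarrow>
     (nat \<Rightarrow> 'a) \<Rightarrow> (nat \<Rightarrow> 'a set) \<Rightarrow> bool" where
  "distribution_stable \<beta> \<delta> cost A F k c C \<longleftrightarrow>
     (\<forall>i<k. \<exists>\<Delta>\<subseteq>C i. real (card \<Delta>) \<ge> (1 - \<delta>) * real (card (C i)) \<and>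
        (\<forall>x\<in>\<Delta>. \<forall>j<k. j \<noteq> i \<longrightarrow>
           cost x (c j) \<ge> \<beta> * opt cost A F k / real (card (C j))))"

definition inner_ring ::
    "('a \<Rightarrow> 'a \<Rightarrow> real) \<Rightarrow> real \<Rightarrow> real \<Rightarrow> ('a \<Rightarrow> 'a \<Rightarrow> real) \<Rightarrow> 'a set \<Rightarrow> 'a set \<Rightarrow> nat \<Rightarrow>
     (nat \<Rightarrow> 'a) \<Rightarrow> (nat \<Rightarrow> 'a set) \<Rightarrow> nat \<Rightarrow> 'a set" where
  "inner_ring d \<epsilon>0 \<beta> cost A F k c C i =
     {x \<in> A \<union> F. d x (c i) \<le> \<epsilon>0 * \<beta> * opt cost A F k / real (card (C i))}"

section \<open>Local search\<close>

definition ls_step ::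
    "('a \<Rightarrow> 'a \<Rightarrow> real) \<Rightarrow> 'a set \<Rightarrow> 'a set \<Rightarrow> nat \<Rightarrow> nat \<Rightarrow> real \<Rightarrow> 'a set \<Rightarrow> 'a set \<Rightarrow> bool" where
  "ls_step cost A F k s \<epsilon> S S' \<longleftrightarrow>
     feasible F k S' \<and> card (S - S') + card (S' - S) \<le> s \<and>
     sol_cost cost A S' \<le> (1 - \<epsilon> / real (card A)) * sol_cost cost A S"

text \<open>The start and every improvement are chosen arbitrarily, so a run may have several outputs.\<close>

definition local_search_output ::
    "('a \<Rightarrow> 'a \<Rightarrow> real) \<Rightarrow> 'a set \<Rightarrow> 'a set \<Rightarrow> nat \<Rightarrow> nat \<Rightarrow> real \<Rightarrow> 'a set \<Rightarrow> bool" where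
  "local_search_output cost A F k s \<epsilon> L \<longleftrightarrow>
     (\<exists>S0. feasible F k S0 \<and> (ls_step cost A F k s \<epsilon>)\<^sup>*\<^sup>* S0 L) \<and>
     (\<nexists>S'. ls_step cost A F k s \<epsilon> L S')"

section \<open>Matching the output with the reference clustering\<close>

text \<open>The cluster of \<open>l \<in> L\<close> under an assignment \<open>\<sigma>\<close> is \<open>{x \<in> A. \<sigma> x = l}\<close>, so a bijection between
  clusters is given as a bijection \<open>\<phi>\<close> from centers in \<open>L\<close> to cluster indices. The output may have
  fewer than \<open>k\<close> centers; then its clusters are padded with empty ones up to \<open>k\<close>, and \<open>\<phi>\<close> is the
  restriction of the bijection to the actual centers.\<close>

definition cluster_bijection :: "'a set \<Rightarrow> nat \<Rightarrow> ('a \<Rightarrow> nat) \<Rightarrow> bool" where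
  "cluster_bijection L k \<phi> \<longleftrightarrow> inj_on \<phi> L \<and> \<phi> ` L \<subseteq> {..<k}"

lemma cluster_bijection_iff_bij_betw:
  assumes "card L = k"
  shows "cluster_bijection L k \<phi> \<longleftrightarrow> bij_betw \<phi> L {..<k}"
  unfolding cluster_bijection_def bij_betw_def
  using assms by (metis card_image card_lessThan card_subset_eq finite_lessThan order_refl)

text \<open>Properties (i) and (ii) of the cluster \<open>C i\<close> with inner ring \<open>R\<close> and the center \<open>l\<close>.\<close>

definition well_served ::
    "real \<Rightarrow> nat \<Rightarrow> (nat \<Rightarrow> 'a set) \<Rightarrow> 'a set \<Rightarrow> ('a \<Rightarrow> 'a) \<Rightarrow> nat \<Rightarrow> 'a \<Rightarrow> bool" where
  "well_served \<epsilon> k C R \<sigma> i l \<longleftrightarrow>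
     real (card {x \<in> R \<inter> C i. \<sigma> x = l}) \<ge> (1 - \<epsilon>) * real (card (R \<inter> C i)) \<and>
     real (card {x \<in> (\<Union>j\<in>{..<k} - {i}. C j). \<sigma> x = l}) \<le> \<epsilon> * real (card (R \<inter> C i))"

end

theory Submission
  imports Defs
begin

text \<open>The single-swap analysis makes the output \<open>L\<close> a constant-factor approximation. Hence all but
  \<open>O(\<epsilon>\<^sup>-\<^sup>3 \<beta>\<^sup>-\<^sup>1)\<close> clusters are cheap, that is, their points pay, in the reference clustering and
  in \<open>L\<close> together, at most a small multiple of \<open>\<beta> * OPT\<close>. Most points of a cheap cluster \<open>C i\<close> lie
  near \<open>c i\<close> and are served by a center near \<open>c i\<close>. By stability the balls around the centers of
  cheap clusters are disjoint, and as \<open>L\<close> has at most \<open>k\<close> centers, all but few of them contain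
  exactly one center \<open>ctr i\<close> of \<open>L\<close>. One large swap exchanges the remaining centers of \<open>L\<close> for the
  reference centers of the remaining clusters, and one swap of size two exchanges each \<open>ctr i\<close> for
  \<open>c i\<close>. A client of a cheap cluster not served by \<open>ctr i\<close>, and a foreign client served by it, pays
  at least the radius of the ball, so moving it by the much smaller distance of \<open>ctr i\<close> and \<open>c i\<close>
  is nearly free. For \<open>\<delta> = 0\<close> every foreign client served by \<open>ctr i\<close> pays almost
  \<open>\<beta> * OPT / |C i|\<close>, so few indices can have many of them.\<close>

section \<open>Counting\<close>

text \<open>Markov's inequality in counting form. It drives the later bounds on expensive clusters,
  far points and foreign clients.\<close>

lemma card_mult_le_sum:
  fixes f :: "'b \<Rightarrow> real"
  assumes "finite I" "J \<subseteq> I" "\<And>i. i \<in> I \<Longrightarrow> 0 \<le> f i" "\<And>i. i \<in> J \<Longrightarrow> T \<le> f i"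
  shows "real (card J) * T \<le> sum f I"
proof -
  have "real (card J) * T = (\<Sum>i\<in>J. T)" by simp
  also have "\<dots> \<le> sum f J" using assms(4) by (rule sum_mono)
  also have "\<dots> \<le> sum f I" using assms by (intro sum_mono2) auto
  finally show ?thesis .
qed

text \<open>Fractional swaps of \<open>l\<close> for \<open>q\<close>; \<open>\<pi>\<close> will be
  the nearest center in \<open>L\<close>. A \<open>q\<close> alone in its fibre trades with
  \<open>\<pi> q\<close>; all other \<open>q\<close> share evenly the centers outside the image of
  \<open>\<pi>\<close>. Hence a removed \<open>l\<close> is never the image of a center of
  \<open>S\<close> other than the inserted one.\<close>

lemma swap_weights:
  fixes \<pi> :: "'b \<Rightarrow> 'c"
  assumes L: "finite L" and S: "finite S" and le: "card S \<le> card L"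
    and \<pi>: "\<And>o'. o' \<in> S \<Longrightarrow> \<pi> o' \<in> L"
  obtains w :: "'c \<Rightarrow> 'b \<Rightarrow> real"
  where "\<And>l q. 0 \<le> w l q"
    and "\<And>l q q'. w l q \<noteq> 0 \<Longrightarrow> q' \<in> S \<Longrightarrow> \<pi> q' = l \<Longrightarrow> q' = q"
    and "\<And>q. q \<in> S \<Longrightarrow> (\<Sum>l\<in>L. w l q) = 1"
    and "\<And>l. l \<in> L \<Longrightarrow> (\<Sum>q\<in>S. w l q) \<le> 2"
proof -
  define L0 where "L0 = L - \<pi> ` S"
  define S1 where "S1 = {q \<in> S. \<forall>q'\<in>S. \<pi> q' = \<pi> q \<longrightarrow> q' = q}"
  define S2 where "S2 = S - S1"
  have fin: "finite L0" "finite S1" "finite S2" using L S by (auto simp: L0_def S1_def S2_def)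
  have S12: "S = S1 \<union> S2" "S1 \<inter> S2 = {}" by (auto simp: S1_def S2_def)
  have fibre: "2 \<le> card {q \<in> S2. \<pi> q = l}" if l: "l \<in> \<pi> ` S2" for l
  proof -
    obtain q where q: "q \<in> S2" "l = \<pi> q" using l by blast
    then obtain q' where q': "q' \<in> S" "\<pi> q' = \<pi> q" "q' \<noteq> q" by (auto simp: S1_def S2_def)
    then have "q' \<in> S2" using q by (auto simp: S1_def S2_def)
    then have "{q, q'} \<subseteq> {q \<in> S2. \<pi> q = l}" using q q' by auto
    then have "card {q, q'} \<le> card {q \<in> S2. \<pi> q = l}" using fin by (intro card_mono) auto
    then show ?thesis using q' by simp
  qed
  have "card S2 = (\<Sum>l\<in>\<pi> ` S2. card {q \<in> S2. \<pi> q = l})"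
    using sum.image_gen[OF fin(3), of "\<lambda>_. 1::nat" \<pi>] by simp
  moreover have "(\<Sum>l\<in>\<pi> ` S2. 2) \<le> (\<Sum>l\<in>\<pi> ` S2. card {q \<in> S2. \<pi> q = l})"
    using fibre by (rule sum_mono)
  ultimately have a: "2 * card (\<pi> ` S2) \<le> card S2" by simp
  have "L \<subseteq> (L0 \<union> \<pi> ` S1) \<union> \<pi> ` S2" using S12 by (auto simp: L0_def)
  then have "card L \<le> card ((L0 \<union> \<pi> ` S1) \<union> \<pi> ` S2)" using fin by (intro card_mono) auto
  also have "\<dots> \<le> card (L0 \<union> \<pi> ` S1) + card (\<pi> ` S2)" by (rule card_Un_le)
  also have "\<dots> \<le> card L0 + card (\<pi> ` S1) + card (\<pi> ` S2)" using card_Un_le by simp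
  also have "\<dots> \<le> card L0 + card S1 + card (\<pi> ` S2)" using card_image_le[OF fin(2)] by simp
  finally have b: "card L \<le> card L0 + card S1 + card (\<pi> ` S2)" .
  have "card S = card S1 + card S2" using S12 fin card_Un_disjoint by metis
  \<comment> \<open>Each center hit by \<open>S2\<close> is hit at least twice and \<open>L\<close>
    is no smaller than \<open>S\<close>, so at least \<open>card S2 / 2\<close> centers of
    \<open>L\<close> are not hit at all.\<close>
  with a b le have cS2: "card S2 \<le> 2 * card L0" by linarith
  define w :: "'c \<Rightarrow> 'b \<Rightarrow> real" where
    "w l q = (if q \<in> S1 then (if \<pi> q = l then 1 else 0)
              else if q \<in> S2 \<and> l \<in> L0 then 1 / real (card L0) else 0)" for l q
  show ?thesis
  proof (rule that)
    show "0 \<le> w l q" for l q by (simp add: w_def)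
    show "q' = q" if "w l q \<noteq> 0" "q' \<in> S" "\<pi> q' = l" for l q q'
      using that by (auto simp: w_def L0_def S1_def split: if_splits)
    show "(\<Sum>l\<in>L. w l q) = 1" if q: "q \<in> S" for q
    proof (cases "q \<in> S1")
      case True
      then show ?thesis using L \<pi>[OF q] by (simp add: w_def)
    next
      case False
      then have q2: "q \<in> S2" using q by (simp add: S2_def)
      then have "0 < card S2" using fin by (auto simp: card_gt_0_iff)
      then have "0 < card L0" using cS2 by simp
      have "(\<Sum>l\<in>L. w l q) = (\<Sum>l\<in>L0. w l q)"
        using L q2 False by (intro sum.mono_neutral_right) (auto simp: w_def L0_def)
      also have "\<dots> = 1" using q2 False \<open>0 < card L0\<close> by (simp add: w_def)
      finally show ?thesis .
    qed
    show "(\<Sum>q\<in>S. w l q) \<le> 2" if l: "l \<in> L" for l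
    proof (cases "l \<in> L0")
      case True
      have "(\<Sum>q\<in>S. w l q) = (\<Sum>q\<in>S2. w l q)"
        using S S12 True by (intro sum.mono_neutral_right) (auto simp: w_def L0_def)
      also have "\<dots> = real (card S2) / real (card L0)"
        using True S12 by (simp add: w_def S2_def)
      also have "\<dots> \<le> 2"
        using cS2 by (cases "card L0 = 0") (auto simp: divide_simps)
      finally show ?thesis .
    next
      case False
      have "(\<Sum>q\<in>S. w l q) = (\<Sum>q\<in>{q \<in> S1. \<pi> q = l}. w l q)"
        using S S12 False by (intro sum.mono_neutral_right) (auto simp: w_def)
      also have "\<dots> = real (card {q \<in> S1. \<pi> q = l})" by (simp add: w_def)
      also have "card {q \<in> S1. \<pi> q = l} \<le> 1"
        by (subst card_le_Suc0_iff_eq[unfolded One_nat_def[symmetric]])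
          (use S in \<open>auto simp: S1_def\<close>)
      finally show ?thesis by simp
    qed
  qed
qed

section \<open>Local optima\<close>

lemma induced_assignment_exists:
  assumes "finite S" "S \<noteq> {}"
  obtains \<sigma> where "induced_assignment d A S \<sigma>"
proof -
  have "\<exists>l\<in>S. \<forall>c\<in>S. d x l \<le> d x c" for x
  proof -
    have "Min (d x ` S) \<in> d x ` S" using assms by (intro Min_in) auto
    then obtain l where "l \<in> S" "d x l = Min (d x ` S)" by auto
    then show ?thesis using assms by (metis Min_le finite_imageI imageI)
  qed
  then obtain \<sigma> where "\<And>x. \<sigma> x \<in> S \<and> (\<forall>c\<in>S. d x (\<sigma> x) \<le> d x c)" by metis
  then show ?thesis by (intro that[of \<sigma>]) (simp add: induced_assignment_def)
qed

lemma sol_cost_eq_sum: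
  assumes "finite S" "induced_assignment d A S \<sigma>"
  shows "sol_cost d A S = (\<Sum>x\<in>A. d x (\<sigma> x))"
  unfolding sol_cost_def
proof (rule sum.cong[OF refl])
  fix x assume "x \<in> A"
  with assms show "Min (d x ` S) = d x (\<sigma> x)"
    by (intro Min_eqI) (auto simp: induced_assignment_def)
qed

text \<open>Local Search enters only through feasibility of \<open>L\<close> and the absence of a
  further step. \<open>2 \<le> s\<close> permits exchanging one center, which counts twice in the
  symmetric difference.\<close>

locale local_optimum = Metric_space X d for X :: "'a set" and d +
  fixes A F :: "'a set" and k :: nat and c :: "nat \<Rightarrow> 'a" and C :: "nat \<Rightarrow> 'a set"
    and \<epsilon> :: real and s :: nat and L :: "'a set" and \<sigma> :: "'a \<Rightarrow> 'a"
  assumes AX: "A \<subseteq> X" and FX: "F \<subseteq> X" and finA: "finite A"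
    and eps: "0 < \<epsilon>" "\<epsilon> < 1/3"
    and cF: "\<And>i. i < k \<Longrightarrow> c i \<in> F"
    and clus: "induced_clustering d A k c C" and Cne: "\<And>i. i < k \<Longrightarrow> C i \<noteq> {}"
    and s2: "2 \<le> s" and Lfeas: "feasible F k L"
    and stuck: "\<not> ls_step d A F k s \<epsilon> L S'"
    and \<sigma>: "induced_assignment d A L \<sigma>"
begin

abbreviation "costL \<equiv> sol_cost d A L"
abbreviation "costC \<equiv> clustering_cost d k c C"

lemma finL: "finite L" and Lne: "L \<noteq> {}" and LF: "L \<subseteq> F" and cardL: "card L \<le> k"
  using Lfeas by (auto simp: feasible_def)

lemma kpos: "0 < k" using finL Lne cardL by (metis card_gt_0_iff le_zero_eq neq0_conv)

lemma UC: "(\<Union>i<k. C i) = A" and disjC: "disjoint_family_on C {..<k}"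
  using clus by (auto simp: induced_clustering_def)

lemma CA: "i < k \<Longrightarrow> C i \<subseteq> A" using UC by auto

lemma finC: "i < k \<Longrightarrow> finite (C i)" using CA finA finite_subset by blast

lemma cardC: "i < k \<Longrightarrow> 0 < card (C i)" using finC Cne by (simp add: card_gt_0_iff)

lemma Cdisj: "\<lbrakk>i < k; j < k; x \<in> C i; x \<in> C j\<rbrakk> \<Longrightarrow> i = j"
  using disjC by (auto simp: disjoint_family_on_def)

lemma inX [simp]:
  "x \<in> A \<Longrightarrow> x \<in> X" "x \<in> F \<Longrightarrow> x \<in> X" "i < k \<Longrightarrow> c i \<in> X" "l \<in> L \<Longrightarrow> l \<in> X"
  "x \<in> A \<Longrightarrow> \<sigma> x \<in> X"
  using AX FX cF LF \<sigma> by (auto simp: induced_assignment_def subset_iff)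

lemma C_inX [simp]: "\<lbrakk>i < k; x \<in> C i\<rbrakk> \<Longrightarrow> x \<in> X" using CA AX by blast

lemma \<sigma>L: "x \<in> A \<Longrightarrow> \<sigma> x \<in> L" and \<sigma>_le: "\<lbrakk>x \<in> A; l \<in> L\<rbrakk> \<Longrightarrow> d x (\<sigma> x) \<le> d x l"
  using \<sigma> by (auto simp: induced_assignment_def)

lemma costL_eq: "costL = (\<Sum>x\<in>A. d x (\<sigma> x))"
  using sol_cost_eq_sum[OF finL \<sigma>] .

lemma sum_clusters: "(\<Sum>x\<in>A. f x) = (\<Sum>i<k. \<Sum>x\<in>C i. f x)"
  unfolding UC[symmetric]
  by (intro sum.UNION_disjoint) (use finC Cdisj in auto)

text \<open>Clusters are disjoint and nonempty. This lets \<open>k\<close> swaps, each with slack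
  \<open>\<epsilon> / real (card A) * costL\<close>, be added at a total loss of
  \<open>\<epsilon> * costL\<close>.\<close>

lemma k_le_n: "k \<le> card A"
proof -
  have "card A = (\<Sum>i<k. card (C i))" using sum_clusters[of "\<lambda>_. 1::nat"] by simp
  moreover have "(\<Sum>i<k. 1) \<le> (\<Sum>i<k. card (C i))"
    by (rule sum_mono) (use cardC in force)
  ultimately show ?thesis by simp
qed

lemma n_pos: "0 < card A" using kpos k_le_n by simp

text \<open>At cost \<open>0\<close> the output itself would still be an improvement, so Local Search would not stop.\<close>

lemma costL_pos: "0 < costL"
proof -
  have "0 \<le> costL" unfolding costL_eq by (intro sum_nonneg) auto
  moreover have "costL \<noteq> 0" using stuck[of L] Lfeas by (auto simp: ls_step_def)
  ultimately show ?thesis by linarith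
qed

text \<open>\<open>S'\<close> is no sufficient improvement, so its saving stays below the threshold.
  As \<open>u\<close> need only bound the distance to some center of \<open>S'\<close>, clients can
  be reassigned by hand.\<close>

lemma swap_bound:
  assumes S': "S' \<subseteq> F" "finite S'" "S' \<noteq> {}" "card S' \<le> k"
    and near: "card (L - S') + card (S' - L) \<le> s"
    and u: "\<And>x. x \<in> A \<Longrightarrow> \<exists>y\<in>S'. d x y \<le> u x"
  shows "(\<Sum>x\<in>A. d x (\<sigma> x) - u x) \<le> \<epsilon> / real (card A) * costL"
proof -
  have "(1 - \<epsilon> / real (card A)) * costL < sol_cost d A S'"
    using stuck[of S'] S' near by (auto simp: ls_step_def feasible_def)
  also have "sol_cost d A S' \<le> (\<Sum>x\<in>A. u x)"
    unfolding sol_cost_def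
  proof (rule sum_mono)
    fix x assume "x \<in> A"
    then obtain y where "y \<in> S'" "d x y \<le> u x" using u by blast
    moreover have "Min (d x ` S') \<le> d x y" using \<open>y \<in> S'\<close> S' by (intro Min_le) auto
    ultimately show "Min (d x ` S') \<le> u x" by linarith
  qed
  finally show ?thesis by (simp add: sum_subtractf costL_eq algebra_simps)
qed

lemma single_swap_bound:
  assumes q: "q \<in> F" and l: "l \<in> L"
    and u: "\<And>x. x \<in> A \<Longrightarrow> d x q \<le> u x \<or> (\<exists>y\<in>L - {l}. d x y \<le> u x)"
  shows "(\<Sum>x\<in>A. d x (\<sigma> x) - u x) \<le> \<epsilon> / real (card A) * costL"
proof (rule swap_bound[where S' = "insert q (L - {l})"])
  show "insert q (L - {l}) \<subseteq> F" using q LF by auto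
  have "card (insert q (L - {l})) \<le> Suc (card (L - {l}))" by (simp add: card_insert_if finL)
  also have "\<dots> = card L" using l finL by (metis card_Suc_Diff1)
  finally show "card (insert q (L - {l})) \<le> k" using cardL by simp
  have "card (L - insert q (L - {l})) \<le> card {l}" by (intro card_mono) auto
  moreover have "card (insert q (L - {l}) - L) \<le> card {q}" by (intro card_mono) auto
  ultimately show "card (L - insert q (L - {l})) + card (insert q (L - {l}) - L) \<le> s"
    using s2 by simp
qed (use finL u in auto)

text \<open>The single-swap argument of Arya et al. in the form of Gupta and Tangwongsan. Instead of
  choosing swap pairs, swaps get fractional weights.\<close>

lemma constant_approx:
  assumes S: "feasible F k S"
  shows "costL \<le> 15 / 2 * sol_cost d A S"
proof -
  have S': "finite S" "S \<noteq> {}" "S \<subseteq> F" "card S \<le> k" using S by (auto simp: feasible_def)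
  obtain \<tau> where \<tau>: "induced_assignment d A S \<tau>" using induced_assignment_exists S' by metis
  have \<tau>S: "\<tau> x \<in> S" if "x \<in> A" for x using \<tau> that by (auto simp: induced_assignment_def)
  have SX: "q \<in> X" if "q \<in> S" for q using S' that by auto
  have cS: "sol_cost d A S = (\<Sum>x\<in>A. d x (\<tau> x))" using sol_cost_eq_sum[OF S'(1) \<tau>] .
  have cS0: "0 \<le> sol_cost d A S" unfolding cS by (intro sum_nonneg) auto
  let ?e = "\<epsilon> / real (card A) * costL"
  have e0: "0 \<le> ?e" using eps costL_pos by simp
  have "real (card S) / real (card A) \<le> 1" using S' k_le_n n_pos by (simp add: divide_simps)
  then have "real (card S) / real (card A) * (\<epsilon> * costL) \<le> 1 * (\<epsilon> * costL)"
    using eps costL_pos by (intro mult_right_mono) auto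
  then have Se: "real (card S) * ?e \<le> \<epsilon> * costL" by (simp add: algebra_simps)
  \<comment> \<open>A client gains once by moving to \<open>\<tau> x\<close> and pays the detour
    \<open>2 * d x (\<tau> x)\<close> with total weight at most 2, whence 1 + 2 * 2 = 5.\<close>
  have key: "costL - 5 * sol_cost d A S \<le> \<epsilon> * costL"
  proof (cases "card S \<le> card L")
    \<comment> \<open>Here \<open>L\<close> has fewer than \<open>k\<close> centers, so a center of
      \<open>S\<close> can be added without removing any, and no detour occurs.\<close>
    case False
    have add: "(\<Sum>x\<in>A. of_bool (\<tau> x = q) * (d x (\<sigma> x) - d x (\<tau> x))) \<le> ?e" if q: "q \<in> S" for q
    proof -
      have "(\<Sum>x\<in>A. d x (\<sigma> x) - (if \<tau> x = q then d x q else d x (\<sigma> x))) \<le> ?e"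
      proof (rule swap_bound[where S' = "insert q L"])
        show "insert q L \<subseteq> F" using q S' LF by auto
        show "card (insert q L) \<le> k" using False S' finL by (simp add: card_insert_if)
        have "card (insert q L - L) \<le> card {q}" by (intro card_mono) auto
        then have "card (insert q L - L) \<le> 1" by simp
        moreover have "card (L - insert q L) = 0" by (simp add: Diff_eq_empty_iff[THEN iffD2] subset_insertI)
        ultimately show "card (L - insert q L) + card (insert q L - L) \<le> s"
          using s2 by linarith
      qed (use finL \<sigma>L in auto)
      moreover have "(\<Sum>x\<in>A. d x (\<sigma> x) - (if \<tau> x = q then d x q else d x (\<sigma> x))) =
          (\<Sum>x\<in>A. of_bool (\<tau> x = q) * (d x (\<sigma> x) - d x (\<tau> x)))"
        by (intro sum.cong) auto
      ultimately show ?thesis by simp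
    qed
    have "costL - sol_cost d A S = (\<Sum>x\<in>A. \<Sum>q\<in>S. of_bool (\<tau> x = q) * (d x (\<sigma> x) - d x (\<tau> x)))"
      using \<tau>S S'(1) by (simp add: costL_eq cS sum_subtractf[symmetric] sum_distrib_right[symmetric]
          of_bool_def cong: sum.cong)
    also have "\<dots> = (\<Sum>q\<in>S. \<Sum>x\<in>A. of_bool (\<tau> x = q) * (d x (\<sigma> x) - d x (\<tau> x)))"
      by (rule sum.swap)
    also have "\<dots> \<le> (\<Sum>q\<in>S. ?e)" using add by (rule sum_mono)
    also have "\<dots> = real (card S) * ?e" by simp
    finally show ?thesis using Se cS0 by linarith
  next
    case True
    obtain \<pi> where \<pi>: "induced_assignment d S L \<pi>" using induced_assignment_exists finL Lne by metis
    have \<pi>L: "\<pi> q \<in> L" and \<pi>le: "\<And>l. l \<in> L \<Longrightarrow> d q (\<pi> q) \<le> d q l" if "q \<in> S" for q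
      using \<pi> that by (auto simp: induced_assignment_def)
    obtain w :: "'a \<Rightarrow> 'a \<Rightarrow> real" where w: "\<And>l q. 0 \<le> w l q"
      "\<And>l q q'. w l q \<noteq> 0 \<Longrightarrow> q' \<in> S \<Longrightarrow> \<pi> q' = l \<Longrightarrow> q' = q"
      "\<And>q. q \<in> S \<Longrightarrow> (\<Sum>l\<in>L. w l q) = 1"
      "\<And>l. l \<in> L \<Longrightarrow> (\<Sum>q\<in>S. w l q) \<le> 2"
      using swap_weights[OF finL S'(1) True, of \<pi>] \<pi>L by blast
    \<comment> \<open>Lower bound for the saving of \<open>x\<close>: clients of \<open>q\<close>
      move to \<open>q\<close>, and other clients of the removed \<open>l\<close> are rerouted to
      the center of \<open>L\<close> nearest to \<open>\<tau> x\<close>.\<close>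
    define h where "h l q x = of_bool (\<tau> x = q) * (d x (\<sigma> x) - d x (\<tau> x))
        - of_bool (\<sigma> x = l) * (2 * d x (\<tau> x))" for l q x
    have sw: "w l q * (\<Sum>x\<in>A. h l q x) \<le> w l q * ?e" if q: "q \<in> S" and l: "l \<in> L" for l q
    proof (cases "w l q = 0")
      case False
      define u where "u x = (if \<tau> x = q then d x (\<tau> x)
          else if \<sigma> x = l then d x (\<sigma> x) + 2 * d x (\<tau> x) else d x (\<sigma> x))" for x
      have "(\<Sum>x\<in>A. h l q x) \<le> (\<Sum>x\<in>A. d x (\<sigma> x) - u x)"
        by (intro sum_mono) (auto simp: h_def u_def)
      also have "\<dots> \<le> ?e"
      proof (rule single_swap_bound[OF _ l])
        show "q \<in> F" using q S' by auto
        fix x assume x: "x \<in> A"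
        show "d x q \<le> u x \<or> (\<exists>y\<in>L - {l}. d x y \<le> u x)"
        proof (cases "\<tau> x = q \<or> \<sigma> x \<noteq> l")
          case True
          then show ?thesis using \<sigma>L[OF x] by (auto simp: u_def)
        next
          case neq: False
          \<comment> \<open>Nonzero weight means that no center of \<open>S\<close> except
            \<open>q\<close> is sent to \<open>l\<close>, so the rerouting target survives the
            swap.\<close>
          have "\<pi> (\<tau> x) \<noteq> l" using w(2)[OF False \<tau>S[OF x]] neq by auto
          moreover have "d x (\<pi> (\<tau> x)) \<le> d x (\<tau> x) + d (\<tau> x) (\<pi> (\<tau> x))"
            using x \<tau>S \<pi>L SX by (intro triangle) auto
          moreover have "d (\<tau> x) (\<pi> (\<tau> x)) \<le> d (\<tau> x) (\<sigma> x)"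
            using x \<tau>S \<pi>le \<sigma>L by auto
          moreover have "d (\<tau> x) (\<sigma> x) \<le> d (\<tau> x) x + d x (\<sigma> x)"
            using x \<tau>S SX by (intro triangle) auto
          moreover have "d (\<tau> x) x = d x (\<tau> x)" by (rule commute)
          ultimately have "d x (\<pi> (\<tau> x)) \<le> u x" "\<pi> (\<tau> x) \<in> L - {l}"
            using neq \<pi>L \<tau>S x by (auto simp: u_def)
          then show ?thesis by blast
        qed
      qed
      finally show ?thesis using w(1) by (intro mult_left_mono) auto
    qed simp
    have "costL - 5 * sol_cost d A S = (\<Sum>x\<in>A. (d x (\<sigma> x) - d x (\<tau> x)) - 2 * (2 * d x (\<tau> x)))"
      by (simp add: costL_eq cS sum_subtractf sum_distrib_left)
    also have "\<dots> \<le> (\<Sum>x\<in>A. (\<Sum>q\<in>S. \<Sum>l\<in>L. w l q * h l q x))"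
    proof (rule sum_mono)
      fix x assume x: "x \<in> A"
      have "(\<Sum>q\<in>S. \<Sum>l\<in>L. w l q * h l q x) =
          (\<Sum>q\<in>S. \<Sum>l\<in>L. of_bool (\<tau> x = q) * (w l q * (d x (\<sigma> x) - d x (\<tau> x)))) -
          (\<Sum>q\<in>S. \<Sum>l\<in>L. of_bool (\<sigma> x = l) * (w l q * (2 * d x (\<tau> x))))"
        unfolding sum_subtractf[symmetric] by (intro sum.cong refl) (simp add: h_def algebra_simps)
      also have "(\<Sum>q\<in>S. \<Sum>l\<in>L. of_bool (\<tau> x = q) * (w l q * (d x (\<sigma> x) - d x (\<tau> x)))) =
          (\<Sum>l\<in>L. w l (\<tau> x)) * (d x (\<sigma> x) - d x (\<tau> x))"
      proof -
        have "(\<Sum>q\<in>S. \<Sum>l\<in>L. of_bool (\<tau> x = q) * (w l q * (d x (\<sigma> x) - d x (\<tau> x)))) =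
            (\<Sum>q\<in>S. if \<tau> x = q then (\<Sum>l\<in>L. w l q) * (d x (\<sigma> x) - d x (\<tau> x)) else 0)"
          by (intro sum.cong refl) (simp add: sum_distrib_right)
        then show ?thesis using S'(1) \<tau>S[OF x] by simp
      qed
      also have "(\<Sum>l\<in>L. w l (\<tau> x)) = 1" using w(3) \<tau>S[OF x] .
      also have "(\<Sum>q\<in>S. \<Sum>l\<in>L. of_bool (\<sigma> x = l) * (w l q * (2 * d x (\<tau> x)))) =
          (\<Sum>q\<in>S. w (\<sigma> x) q) * (2 * d x (\<tau> x))"
        using finL \<sigma>L[OF x]
        by (simp add: sum_distrib_right of_bool_def
            if_distrib[of "\<lambda>z. z * _"] cong: if_cong)
      finally have *: "(\<Sum>q\<in>S. \<Sum>l\<in>L. w l q * h l q x) =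
          1 * (d x (\<sigma> x) - d x (\<tau> x)) - (\<Sum>q\<in>S. w (\<sigma> x) q) * (2 * d x (\<tau> x))" .
      have "(\<Sum>q\<in>S. w (\<sigma> x) q) * (2 * d x (\<tau> x)) \<le> 2 * (2 * d x (\<tau> x))"
        using w(4)[OF \<sigma>L[OF x]] by (intro mult_right_mono) auto
      then show "(d x (\<sigma> x) - d x (\<tau> x)) - 2 * (2 * d x (\<tau> x)) \<le>
          (\<Sum>q\<in>S. \<Sum>l\<in>L. w l q * h l q x)" unfolding * mult_1 by (rule diff_left_mono)
    qed
    also have "\<dots> = (\<Sum>q\<in>S. \<Sum>l\<in>L. w l q * (\<Sum>x\<in>A. h l q x))"
      unfolding sum_distrib_left
      by (subst sum.swap, rule sum.cong[OF refl], subst sum.swap) simp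
    also have "\<dots> \<le> (\<Sum>q\<in>S. \<Sum>l\<in>L. w l q * ?e)" using sw by (intro sum_mono) auto
    also have "\<dots> = real (card S) * ?e"
      unfolding sum_distrib_right[symmetric] using w(3) by simp
    finally show ?thesis using Se by linarith
  qed
  \<comment> \<open>\<open>\<epsilon> < 1/3\<close> bounds the factor
    \<open>5 / (1 - \<epsilon>)\<close> by 15/2.\<close>
  have "costL * (2/3) \<le> costL * (1 - \<epsilon>)" using eps costL_pos by (intro mult_left_mono) auto
  then show ?thesis using key by (simp add: algebra_simps)
qed

section \<open>Comparison with the reference clustering and the optimum\<close>

lemma costC_eq: "costC = (\<Sum>i<k. \<Sum>x\<in>C i. d x (c i))"
  by (simp add: clustering_cost_def)

lemma costC_ge_sol_cost: "sol_cost d A (c ` {..<k}) \<le> costC"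
  unfolding costC_eq sol_cost_def sum_clusters
  by (intro sum_mono Min_le) auto

lemma centers_feasible: "feasible F k (c ` {..<k})"
  using kpos cF card_image_le[of "{..<k}" c] by (auto simp: feasible_def lessThan_empty_iff)

lemma costL_le_costC: "costL \<le> 15 / 2 * costC"
  using constant_approx[OF centers_feasible] costC_ge_sol_cost by linarith

text \<open>The factor holds against every feasible set, so it passes to the infimum, attained or
  not.\<close>

lemma costL_le_opt: "costL \<le> 15 / 2 * opt d A F k"
proof -
  have "2 / 15 * costL \<le> opt d A F k"
    unfolding opt_def
    by (rule cINF_greatest) (use Lfeas constant_approx in \<open>auto simp: field_simps\<close>)
  then show ?thesis by simp
qed

lemma opt_pos: "0 < opt d A F k"
  using costL_le_opt costL_pos by linarith

end

section \<open>Isolated clusters\<close>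

text \<open>\<open>D\<close> stands for \<open>\<beta> * OPT\<close>, and \<open>\<kappa>\<close> bounds the fraction of a cheap cluster that is lost by
  restricting to its points near \<open>c i\<close>; stability leaves more than that fraction.\<close>

locale stable_local_optimum = local_optimum +
  fixes D \<kappa> \<rho> :: real
  assumes D: "0 < D" and \<rho>: "0 < \<rho>" "\<rho> \<le> 1/9" and \<kappa>: "0 < \<kappa>"
    and stable: "i < k \<Longrightarrow> \<exists>\<Delta>\<subseteq>C i. \<kappa> * real (card (C i)) < real (card \<Delta>) \<and>
      (\<forall>x\<in>\<Delta>. \<forall>j<k. j \<noteq> i \<longrightarrow> D / real (card (C j)) \<le> d x (c j))"
begin

section \<open>Cheap clusters and the points near their centers\<close>

definition r :: "nat \<Rightarrow> real" where "r i = D / real (card (C i))"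
definition t :: "nat \<Rightarrow> real" where "t i = (\<Sum>x\<in>C i. d x (c i) + d x (\<sigma> x))"
text \<open>A point of \<open>C i\<close> outside \<open>near i\<close> pays at least
  \<open>\<rho> * D / card (C i)\<close>, so this threshold allows at most a \<open>\<kappa>\<close>
  fraction of such points.\<close>

definition cheap :: "nat set" where "cheap = {i. i < k \<and> t i \<le> \<kappa> * \<rho> * D}"
definition near :: "nat \<Rightarrow> 'a set" where
  "near i = {x \<in> C i. d x (c i) + d x (\<sigma> x) < \<rho> * r i}"
definition U :: "nat \<Rightarrow> 'a set" where "U i = {l \<in> L. d (c i) l < \<rho> * r i}"
definition isolated :: "nat set" where "isolated = {i \<in> cheap. card (U i) = 1}"
text \<open>Meaningful only for isolated \<open>i\<close>, where \<open>U i\<close> is a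
  singleton.\<close>

definition ctr :: "nat \<Rightarrow> 'a" where "ctr i = the_elem (U i)"

lemma r_pos: "i < k \<Longrightarrow> 0 < r i" using D cardC by (simp add: r_def)

lemma r_card: "i < k \<Longrightarrow> r i * real (card (C i)) = D" using cardC by (force simp: r_def)

lemma t_nonneg: "0 \<le> t i" unfolding t_def by (intro sum_nonneg) auto

lemma sum_t: "(\<Sum>i<k. t i) = costC + costL"
  by (simp add: t_def costC_eq costL_eq sum_clusters sum.distrib)

lemma card_expensive: "real (card ({..<k} - cheap)) * (\<kappa> * \<rho> * D) \<le> costC + costL"
  unfolding sum_t[symmetric]
  by (rule card_mult_le_sum) (auto simp: t_nonneg cheap_def)

lemma card_far:
  assumes "i \<in> cheap" shows "real (card (C i - near i)) \<le> \<kappa> * real (card (C i))"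
proof -
  have i: "i < k" "t i \<le> \<kappa> * \<rho> * D" using assms by (auto simp: cheap_def)
  have "real (card (C i - near i)) * (\<rho> * r i) \<le> t i"
    unfolding t_def by (rule card_mult_le_sum) (use finC i in \<open>auto simp: near_def\<close>)
  also have "\<dots> \<le> (\<kappa> * real (card (C i))) * (\<rho> * r i)"
    using i r_card[OF i(1)] by (simp add: algebra_simps)
  finally show ?thesis using \<rho> r_pos[OF i(1)] by (simp add: mult_le_cancel_right)
qed

lemma card_near:
  assumes "i \<in> cheap" shows "(1 - \<kappa>) * real (card (C i)) \<le> real (card (near i))"
proof -
  have "near i \<subseteq> C i" "finite (C i)" using assms finC by (auto simp: near_def cheap_def)
  then have "card (C i) = card (near i) + card (C i - near i)"
    by (metis card_Diff_subset card_mono finite_subset le_add_diff_inverse)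
  then show ?thesis using card_far[OF assms] by (simp add: algebra_simps)
qed

text \<open>Far points form at most a \<open>\<kappa>\<close> fraction of \<open>C i\<close> and
  stable ones more, so some stable point is near.\<close>

lemma near_stable:
  assumes "i \<in> cheap"
  obtains x where "x \<in> near i" "\<And>j. \<lbrakk>j < k; j \<noteq> i\<rbrakk> \<Longrightarrow> r j \<le> d x (c j)"
proof -
  have i: "i < k" using assms by (auto simp: cheap_def)
  obtain \<Delta> where \<Delta>: "\<Delta> \<subseteq> C i" "\<kappa> * real (card (C i)) < real (card \<Delta>)"
    "\<And>x j. \<lbrakk>x \<in> \<Delta>; j < k; j \<noteq> i\<rbrakk> \<Longrightarrow> r j \<le> d x (c j)"
    using stable[OF i] unfolding r_def by blast
  have "\<not> \<Delta> \<subseteq> C i - near i"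
  proof
    assume "\<Delta> \<subseteq> C i - near i"
    then have "card \<Delta> \<le> card (C i - near i)" using finC[OF i] by (intro card_mono) auto
    then show False using card_far[OF assms] \<Delta>(2) by linarith
  qed
  then show ?thesis using \<Delta> that by blast
qed

lemma near_U:
  assumes "i < k" "x \<in> near i" shows "\<sigma> x \<in> U i"
proof -
  have x: "x \<in> C i" "x \<in> A" "d x (c i) + d x (\<sigma> x) < \<rho> * r i"
    using assms CA by (auto simp: near_def)
  have "d (c i) (\<sigma> x) \<le> d (c i) x + d x (\<sigma> x)" using assms x by (intro triangle) auto
  then show ?thesis using x \<sigma>L by (simp add: U_def commute)
qed

text \<open>Triangle inequality through a stable near point of \<open>C i\<close>. Only
  \<open>C i\<close> has to be cheap, but the main term is the radius of \<open>C j\<close>.\<close>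

lemma center_separation:
  assumes "i \<in> cheap" "j < k" "j \<noteq> i" shows "r j - \<rho> * r i \<le> d (c i) (c j)"
proof -
  have i: "i < k" using assms by (auto simp: cheap_def)
  obtain x where x: "x \<in> near i" "r j \<le> d x (c j)" using near_stable[OF assms(1)] assms by metis
  then have "x \<in> C i" "d x (c i) < \<rho> * r i"
    using nonneg[of x "\<sigma> x"] by (auto simp: near_def simp del: nonneg)
  moreover have "d x (c j) \<le> d x (c i) + d (c i) (c j)"
    using i \<open>x \<in> C i\<close> assms by (intro triangle) auto
  ultimately show ?thesis using x by linarith
qed

text \<open>Sum of the two asymmetric bounds with \<open>\<rho> \<le> 1/9\<close>: twice the
  distance is at least 8/9 of \<open>r i + r j\<close>.\<close>

lemma cheap_separation:
  assumes "i \<in> cheap" "j \<in> cheap" "j \<noteq> i" shows "4 * r i + 4 * r j \<le> 9 * d (c i) (c j)"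
proof -
  have ij: "i < k" "j < k" using assms by (auto simp: cheap_def)
  have "r j - \<rho> * r i \<le> d (c i) (c j)" "r i - \<rho> * r j \<le> d (c i) (c j)"
    using center_separation[of i j] center_separation[of j i] assms ij commute[of "c i" "c j"] by auto
  moreover have "\<rho> * r i \<le> 1/9 * r i" "\<rho> * r j \<le> 1/9 * r j"
    using \<rho> r_pos[OF ij(1)] r_pos[OF ij(2)] by (auto intro!: mult_right_mono)
  ultimately show ?thesis by linarith
qed

lemma U_disjoint:
  assumes "i \<in> cheap" "j \<in> cheap" "l \<in> U i" "l \<in> U j" shows "i = j"
proof (rule ccontr)
  assume ne: "i \<noteq> j"
  have ij: "i < k" "j < k" using assms by (auto simp: cheap_def)
  have "4 * r i + 4 * r j \<le> 9 * d (c i) (c j)" using cheap_separation assms ne by auto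
  moreover have "d (c i) (c j) \<le> d (c i) l + d l (c j)"
    using assms ij by (intro triangle) (auto simp: U_def)
  moreover have "d (c i) l < \<rho> * r i" "d l (c j) < \<rho> * r j"
    using assms commute[of l "c j"] by (auto simp: U_def)
  moreover have "\<rho> * r i \<le> 1/9 * r i" "\<rho> * r j \<le> 1/9 * r j"
    using \<rho> r_pos[OF ij(1)] r_pos[OF ij(2)] by (auto intro!: mult_right_mono)
  ultimately show False using r_pos[OF ij(1)] r_pos[OF ij(2)] by linarith
qed

lemma isolated_sub: "isolated \<subseteq> cheap" "cheap \<subseteq> {..<k}" "isolated \<subseteq> {..<k}"
  by (auto simp: isolated_def cheap_def)

text \<open>Every cheap cluster has a center of \<open>L\<close> close by, but \<open>L\<close> has only \<open>k\<close> centers: each cheap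
  cluster with two or more of them is compensated by an expensive one.\<close>

lemma card_not_isolated: "card ({..<k} - isolated) \<le> 2 * card ({..<k} - cheap)"
proof -
  have fin: "finite cheap" "finite isolated" using isolated_sub finite_subset by blast+
  have finU: "finite (U i)" for i using finL by (simp add: U_def)
  have Une: "1 \<le> card (U i)" if i: "i \<in> cheap" for i
  proof -
    obtain x where "x \<in> near i" using near_stable[OF i] by metis
    then have "U i \<noteq> {}" using near_U i by (auto simp: cheap_def)
    then show ?thesis using finU by (simp add: Suc_le_eq card_gt_0_iff)
  qed
  have "(\<Sum>i\<in>cheap. (if i \<in> isolated then 1 else 2)) \<le> (\<Sum>i\<in>cheap. card (U i))"
  proof (rule sum_mono)
    fix i assume "i \<in> cheap"
    then show "(if i \<in> isolated then 1 else 2) \<le> card (U i)"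
      using Une[of i] by (auto simp: isolated_def)
  qed
  also have "\<dots> = card (\<Union>i\<in>cheap. U i)"
    using fin finU U_disjoint by (subst card_UN_disjoint) (auto dest: U_disjoint)
  also have "\<dots> \<le> card L" using finL by (intro card_mono) (auto simp: U_def)
  also have "\<dots> \<le> k" by (rule cardL)
  finally have "(\<Sum>i\<in>cheap. (if i \<in> isolated then 1 else 2)) \<le> k" .
  \<comment> \<open>Adding \<open>card isolated\<close> completes every weight to 2; the resulting
    bound is then subtracted from \<open>2 * k\<close>.\<close>
  moreover have "(\<Sum>i\<in>cheap. (if i \<in> isolated then 1 else 2)) + card isolated =
      (\<Sum>i\<in>cheap. (if i \<in> isolated then 1 else 2) + (if i \<in> isolated then 1 else 0))"
    unfolding sum.distrib using fin isolated_sub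
    by (simp add: sum.If_cases Int_absorb1 inf.absorb2 flip: card_eq_sum)
  moreover have "\<dots> = (\<Sum>i\<in>cheap. 2::nat)" by (intro sum.cong) auto
  moreover have "\<dots> = 2 * card cheap" by simp
  ultimately have "2 * card cheap \<le> k + card isolated" by linarith
  moreover have "card ({..<k} - isolated) = k - card isolated"
    "card ({..<k} - cheap) = k - card cheap"
    using fin isolated_sub by (simp_all add: card_Diff_subset)
  moreover have "card cheap \<le> k" using isolated_sub(2) by (metis card_lessThan card_mono finite_lessThan)
  ultimately show ?thesis by linarith
qed

section \<open>The unique nearby center of an isolated cluster\<close>

lemma U_eq: "i \<in> isolated \<Longrightarrow> U i = {ctr i}"
proof -
  assume "i \<in> isolated"
  then have "card (U i) = 1" by (simp add: isolated_def)
  then obtain l where "U i = {l}" by (rule card_1_singletonE)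
  then show ?thesis by (simp add: ctr_def)
qed

lemma ctr_L: "i \<in> isolated \<Longrightarrow> ctr i \<in> L" and ctr_near: "i \<in> isolated \<Longrightarrow> d (c i) (ctr i) < \<rho> * r i"
  using U_eq by (auto simp: U_def)

lemma inj_ctr: "inj_on ctr isolated"
proof (rule inj_onI)
  fix i j assume "i \<in> isolated" "j \<in> isolated" "ctr i = ctr j"
  then show "i = j" using U_eq[of i] U_eq[of j] isolated_sub by (intro U_disjoint[of i j "ctr i"]) auto
qed

lemma near_ctr: "\<lbrakk>i \<in> isolated; x \<in> near i\<rbrakk> \<Longrightarrow> \<sigma> x = ctr i"
  using near_U[of i x] U_eq[of i] isolated_sub by auto


text \<open>Most points of \<open>C i\<close> witness the distance of \<open>c i\<close> and \<open>ctr i\<close>, so averaging gains a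
  factor \<open>\<kappa>\<close> over the radius of \<open>U i\<close>.\<close>

lemma ctr_close:
  assumes i: "i \<in> isolated" and \<kappa>2: "\<kappa> \<le> 1/2"
  shows "d (c i) (ctr i) \<le> 2 * \<kappa> * \<rho> * r i"
proof -
  have ik: "i < k" "i \<in> cheap" "t i \<le> \<kappa> * \<rho> * D"
    using i by (auto simp: isolated_def cheap_def)
  have "real (card (near i)) * d (c i) (ctr i) \<le> t i"
    unfolding t_def
  proof (rule card_mult_le_sum)
    fix x assume x: "x \<in> near i"
    then have "x \<in> C i" "x \<in> A" using ik CA by (auto simp: near_def)
    then have "d (c i) (\<sigma> x) \<le> d (c i) x + d x (\<sigma> x)" using ik by (intro triangle) auto
    then show "d (c i) (ctr i) \<le> d x (c i) + d x (\<sigma> x)"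
      using near_ctr[OF i x] by (simp add: commute)
  qed (use finC ik in \<open>auto simp: near_def\<close>)
  moreover have "1/2 * real (card (C i)) * d (c i) (ctr i) \<le> real (card (near i)) * d (c i) (ctr i)"
  proof (rule mult_right_mono)
    have "1/2 * real (card (C i)) \<le> (1 - \<kappa>) * real (card (C i))"
      using \<kappa>2 by (intro mult_right_mono) auto
    then show "1/2 * real (card (C i)) \<le> real (card (near i))" using card_near[OF ik(2)] by linarith
  qed simp
  ultimately have "1/2 * real (card (C i)) * d (c i) (ctr i) \<le> \<kappa> * \<rho> * (r i * real (card (C i)))"
    using ik r_card by simp
  then have "real (card (C i)) * d (c i) (ctr i) \<le> real (card (C i)) * (2 * \<kappa> * \<rho> * r i)"
    by (simp add: algebra_simps)
  then show ?thesis using cardC[OF ik(1)] by (simp add: mult_le_cancel_left)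
qed

text \<open>Stability for \<open>C i\<close> bounds the distance from \<open>c i\<close> to \<open>c j\<close> by \<open>r j\<close>, which may be tiny when
  \<open>C j\<close> is expensive, so separation at the scale \<open>r i\<close> has to be asked for.\<close>

definition sep :: "nat set" where
  "sep = {i \<in> isolated. \<forall>j<k. j \<noteq> i \<longrightarrow> r i / 4 < d (c i) (c j)}"

lemma sep_sub: "sep \<subseteq> isolated" "sep \<subseteq> {..<k}" "finite sep"
  using isolated_sub finite_subset[of sep "{..<k}"] by (auto simp: sep_def)

text \<open>An isolated cluster violating separation has an expensive center within
  \<open>r i / 4\<close>, since cheap ones are farther away. Two such clusters cannot share that
  center, as their own centers would be too close. So each expensive cluster spoils at most one
  more, besides the two indices counted in \<open>card_not_isolated\<close>.\<close>

lemma card_not_sep: "card ({..<k} - sep) \<le> 3 * card ({..<k} - cheap)"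
proof -
  have "\<exists>j. j \<in> {..<k} - cheap \<and> d (c i) (c j) \<le> r i / 4" if i: "i \<in> isolated - sep" for i
  proof -
    obtain j where j: "j < k" "j \<noteq> i" "d (c i) (c j) \<le> r i / 4"
      using i by (auto simp: sep_def not_less)
    have ik: "i \<in> cheap" "i < k" using i isolated_sub by auto
    have "j \<notin> cheap"
    proof
      assume "j \<in> cheap"
      then have "4 * r i + 4 * r j \<le> 9 * d (c i) (c j)" using cheap_separation ik j by auto
      then show False using j r_pos[OF ik(2)] r_pos[OF j(1)] by linarith
    qed
    then show ?thesis using j by auto
  qed
  then obtain g where g: "\<And>i. i \<in> isolated - sep \<Longrightarrow> g i \<in> {..<k} - cheap"
    "\<And>i. i \<in> isolated - sep \<Longrightarrow> d (c i) (c (g i)) \<le> r i / 4" by metis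
  have "inj_on g (isolated - sep)"
  proof (rule inj_onI, rule ccontr)
    fix i j assume ij: "i \<in> isolated - sep" "j \<in> isolated - sep" "g i = g j" "i \<noteq> j"
    then have k: "i < k" "j < k" "i \<in> cheap" "j \<in> cheap" "g i < k" using isolated_sub g(1)[OF ij(1)] by auto
    have "4 * r i + 4 * r j \<le> 9 * d (c i) (c j)" using cheap_separation k ij by auto
    moreover have "d (c i) (c j) \<le> d (c i) (c (g i)) + d (c (g i)) (c j)" using k by (intro triangle) auto
    moreover have "d (c i) (c (g i)) + d (c (g i)) (c j) \<le> r i / 4 + r j / 4"
      using g(2)[OF ij(1)] g(2)[OF ij(2)] ij(3) commute[of "c (g i)" "c j"] by simp
    ultimately show False using r_pos[OF k(1)] r_pos[OF k(2)] by linarith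
  qed
  then have "card (isolated - sep) \<le> card ({..<k} - cheap)"
    using g(1) by (intro card_inj_on_le[of g]) auto
  moreover have "{..<k} - sep = ({..<k} - isolated) \<union> (isolated - sep)"
    using isolated_sub sep_sub by auto
  then have "card ({..<k} - sep) \<le> card ({..<k} - isolated) + card (isolated - sep)"
    by (metis card_Un_le)
  ultimately show ?thesis using card_not_isolated by linarith
qed

text \<open>The large swap alone accounts for clients of clusters in \<open>B\<close> and for those served by a removed
  center, and the swap of \<open>ctr i\<close> for \<open>c i\<close> for all other clients of \<open>C i\<close>. The bounds \<open>u\<close> and \<open>v\<close>
  exceed the old cost of a client only by its share of the error term.\<close>

lemma sep_approx:
  assumes \<kappa>2: "\<kappa> \<le> 1/3" and size: "2 * card ({..<k} - sep) \<le> s"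
  shows "costL - costC - 2 * \<kappa> * (costC + costL) \<le> 2 * \<epsilon> * costL"
proof -
  define B where "B = {..<k} - sep"
  let ?e = "\<epsilon> / real (card A) * costL"
  have e0: "0 \<le> ?e" using eps costL_pos by simp
  define cl where "cl x = (THE i. i < k \<and> x \<in> C i)" for x
  have cl_eq: "cl x = i" if "i < k" "x \<in> C i" for x i
    unfolding cl_def by (rule the_equality) (use that Cdisj in auto)
  have cl: "cl x < k" "x \<in> C (cl x)" if x: "x \<in> A" for x
  proof -
    obtain i where "i < k" "x \<in> C i" using x UC by blast
    then show "cl x < k" "x \<in> C (cl x)" using cl_eq by auto
  qed
  define q where "q x = d x (c (cl x))" for x
  define l where "l x = d x (\<sigma> x)" for x
  have ql0: "0 \<le> q x" "0 \<le> l x" for x by (simp_all add: q_def l_def)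
  have costC': "costC = (\<Sum>x\<in>A. q x)"
    unfolding sum_clusters costC_eq q_def by (intro sum.cong refl) (auto simp: cl_eq)
  have costL': "costL = (\<Sum>x\<in>A. l x)" by (simp add: costL_eq l_def)
  have close: "d (c i) (ctr i) \<le> 2 * \<kappa> * \<rho> * r i" if "i \<in> sep" for i
    using ctr_close that sep_sub \<kappa>2 by auto
  have sepD: "i \<in> isolated" "i < k" "ctr i \<in> L" "0 < r i" if "i \<in> sep" for i
    using that sep_sub ctr_L r_pos by auto
  have far_ctr: "\<rho> * r i \<le> q x + l x"
    if x: "x \<in> A" and i: "i \<in> sep" "i = cl x" and ne: "\<sigma> x \<noteq> ctr i" for x i
  proof -
    have "x \<notin> near i" using near_ctr sepD(1)[OF i(1)] ne by blast
    then show ?thesis using cl(2)[OF x] i by (auto simp: near_def q_def l_def)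
  qed
  \<comment> \<open>Separation leaves more than (1/4 - 1/9) \<open>r i\<close>, which exceeds
    \<open>r i / 9\<close>.\<close>
  have far_cl: "\<rho> * r i \<le> q x + l x"
    if x: "x \<in> A" and i: "i \<in> sep" "i \<noteq> cl x" and eq: "\<sigma> x = ctr i" for x i
  proof -
    note i' = sepD[OF i(1)]
    have "r i / 4 < d (c i) (c (cl x))" using i cl[OF x] by (auto simp: sep_def)
    also have "\<dots> \<le> d (c i) (ctr i) + d (ctr i) (c (cl x))"
      using i' cl[OF x] by (intro triangle) auto
    also have "d (ctr i) (c (cl x)) \<le> d (ctr i) x + d x (c (cl x))"
      using i' x cl[OF x] by (intro triangle) auto
    also have "d (ctr i) x = l x" using eq by (simp add: l_def commute)
    finally have "r i / 4 < d (c i) (ctr i) + (l x + q x)" by (simp add: q_def)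
    moreover have "d (c i) (ctr i) < \<rho> * r i" using ctr_near i' by simp
    moreover have "\<rho> * r i \<le> 1/9 * r i" using \<rho> i' by (intro mult_right_mono) auto
    ultimately show ?thesis using i'(4) by linarith
  qed
  have \<kappa>far: "2 * \<kappa> * \<rho> * r i \<le> 2 * \<kappa> * (q x + l x)" if "\<rho> * r i \<le> q x + l x" for i x
    using mult_left_mono[OF that, of "2 * \<kappa>"] \<kappa> by (simp add: algebra_simps)
  define u where "u x = (if cl x \<in> B then q x else if \<sigma> x \<in> ctr ` sep then l x
      else q x + 2 * \<kappa> * (q x + l x))" for x
  have big: "(\<Sum>x\<in>A. l x - u x) \<le> ?e"
    unfolding l_def
  proof (rule swap_bound[where S' = "ctr ` sep \<union> c ` B"])
    show "ctr ` sep \<union> c ` B \<subseteq> F" using sepD LF cF by (auto simp: B_def)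
    show "finite (ctr ` sep \<union> c ` B)" using sep_sub by (simp add: B_def)
    show "ctr ` sep \<union> c ` B \<noteq> {}" using kpos by (auto simp: B_def)
    have inj: "inj_on ctr sep" using inj_ctr sep_sub inj_on_subset by blast
    have cB: "card (c ` B) \<le> card B" by (intro card_image_le) (simp add: B_def)
    have ck: "card sep + card B = k"
      unfolding B_def using sep_sub
      by (metis card_Diff_subset card_lessThan card_mono finite_lessThan le_add_diff_inverse)
    have "card (ctr ` sep \<union> c ` B) \<le> card (ctr ` sep) + card (c ` B)" by (rule card_Un_le)
    also have "\<dots> \<le> card sep + card B" using cB card_image[OF inj] by simp
    finally show "card (ctr ` sep \<union> c ` B) \<le> k" using ck by simp
    \<comment> \<open>At most \<open>k - card sep = card B\<close> centers leave and at most
      \<open>card B\<close> enter, which is why \<open>s\<close> must reach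
      \<open>2 * card B\<close>.\<close>
    have "card (L - (ctr ` sep \<union> c ` B)) \<le> card (L - ctr ` sep)" using finL by (intro card_mono) auto
    also have "\<dots> = card L - card (ctr ` sep)" using sepD sep_sub by (intro card_Diff_subset) auto
    finally have "card (L - (ctr ` sep \<union> c ` B)) \<le> card B" using ck cardL card_image[OF inj] by linarith
    moreover have "card (ctr ` sep \<union> c ` B - L) \<le> card (c ` B)"
      using sepD by (intro card_mono) (auto simp: B_def)
    ultimately show "card (L - (ctr ` sep \<union> c ` B)) + card (ctr ` sep \<union> c ` B - L) \<le> s"
      using cB size by (simp add: B_def)
    fix x assume x: "x \<in> A"
    show "\<exists>y\<in>ctr ` sep \<union> c ` B. d x y \<le> u x"
    proof (cases "cl x \<in> B \<or> \<sigma> x \<in> ctr ` sep")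
      case True
      then show ?thesis by (auto simp: u_def q_def l_def)
    next
      case False
      then have i: "cl x \<in> sep" using cl[OF x] by (auto simp: B_def)
      have "d x (ctr (cl x)) \<le> q x + d (c (cl x)) (ctr (cl x))"
        unfolding q_def using x cl[OF x] sepD[OF i] by (intro triangle) auto
      moreover have "\<rho> * r (cl x) \<le> q x + l x" using far_ctr[OF x i refl] i False by auto
      ultimately have "d x (ctr (cl x)) \<le> u x"
        using close[OF i] \<kappa>far[of "cl x" x] False by (simp add: u_def)
      then show ?thesis using i by blast
    qed
  qed
  \<comment> \<open>Foreign clients of \<open>ctr i\<close> follow it to \<open>c i\<close>; clients
    of \<open>C i\<close> served elsewhere take the better of \<open>c i\<close> and their old
    center.\<close>
  define v where "v i x = (if \<sigma> x = ctr i \<and> cl x \<noteq> i then l x + 2 * \<kappa> * (q x + l x)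
      else if cl x = i then (if \<sigma> x = ctr i then q x else min (q x) (l x)) else l x)" for i x
  have single: "(\<Sum>x\<in>A. l x - v i x) \<le> ?e" if i: "i \<in> sep" for i
    unfolding l_def
  proof (rule single_swap_bound[of "c i" "ctr i"])
    note i' = sepD[OF i]
    show "c i \<in> F" "ctr i \<in> L" using i' cF by auto
    fix x assume x: "x \<in> A"
    show "d x (c i) \<le> v i x \<or> (\<exists>y\<in>L - {ctr i}. d x y \<le> v i x)"
    proof (cases "\<sigma> x = ctr i \<and> cl x \<noteq> i")
      case True
      have "d x (c i) \<le> d x (ctr i) + d (ctr i) (c i)" using x i' by (intro triangle) auto
      moreover have "d (ctr i) (c i) \<le> 2 * \<kappa> * \<rho> * r i" using close[OF i] commute by simp
      moreover have "\<rho> * r i \<le> q x + l x" using far_cl[OF x i] True by auto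
      ultimately have "d x (c i) \<le> v i x" using True \<kappa>far[of i x] by (simp add: v_def l_def)
      then show ?thesis ..
    next
      case False
      then show ?thesis using \<sigma>L[OF x] by (auto simp: v_def l_def q_def min_def)
    qed
  qed
  have "costL - costC - 2 * \<kappa> * (costC + costL) =
      (\<Sum>x\<in>A. l x - q x - 2 * \<kappa> * (q x + l x))"
    unfolding sum_subtractf sum_distrib_left[symmetric] sum.distrib costC' costL' by simp
  also have "\<dots> \<le> (\<Sum>x\<in>A. (l x - u x) + (\<Sum>i\<in>sep. l x - v i x))"
  proof (rule sum_mono)
    fix x assume x: "x \<in> A"
    define \<mu> where "\<mu> = 2 * \<kappa> * (q x + l x)"
    have \<mu>0: "0 \<le> \<mu>" using \<kappa> ql0[of x] by (simp add: \<mu>_def)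
    \<comment> \<open>\<open>a\<close> is the gain of \<open>x\<close> in the swap for its own
      cluster, \<open>b\<close> its loss in the swap of a foreign \<open>ctr i\<close> serving it.
      As \<open>ctr\<close> is injective, that loss occurs at most once.\<close>
    define a where "a = (if cl x \<in> sep then (if \<sigma> x = ctr (cl x) then l x - q x
        else l x - min (q x) (l x)) else 0)"
    define b where "b = (if \<exists>i\<in>sep. \<sigma> x = ctr i \<and> i \<noteq> cl x then \<mu> else 0)"
    have "(\<Sum>i\<in>sep. l x - v i x) = (\<Sum>i\<in>sep. (if i = cl x then a else 0)) -
        (\<Sum>i\<in>sep. (if \<sigma> x = ctr i \<and> i \<noteq> cl x then \<mu> else 0))"
      unfolding sum_subtractf[symmetric] by (intro sum.cong refl) (auto simp: v_def a_def \<mu>_def)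
    also have "(\<Sum>i\<in>sep. (if i = cl x then a else 0)) = a" using sep_sub by (simp add: a_def)
    also have "(\<Sum>i\<in>sep. (if \<sigma> x = ctr i \<and> i \<noteq> cl x then \<mu> else 0)) = b"
    proof (cases "\<exists>i\<in>sep. \<sigma> x = ctr i \<and> i \<noteq> cl x")
      case True
      then obtain i where i: "i \<in> sep" "\<sigma> x = ctr i" "i \<noteq> cl x" by blast
      have "(\<Sum>j\<in>sep. (if \<sigma> x = ctr j \<and> j \<noteq> cl x then \<mu> else 0)) = (\<Sum>j\<in>sep. (if j = i then \<mu> else 0))"
        using i inj_onD[OF inj_ctr] sepD(1) by (intro sum.cong refl) auto
      then show ?thesis using i sep_sub True by (simp add: b_def)
    next
      case False
      then show ?thesis unfolding b_def by (auto intro!: sum.neutral)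
    qed
    finally have eq: "(\<Sum>i\<in>sep. l x - v i x) = a - b" .
    have "l x - q x - \<mu> \<le> (l x - u x) + (a - b)"
    proof (cases "cl x \<in> sep")
      case False
      then have "cl x \<in> B" using cl[OF x] by (simp add: B_def)
      then show ?thesis using False \<mu>0 by (auto simp: u_def a_def b_def)
    next
      case True
      then have nB: "cl x \<notin> B" by (simp add: B_def)
      consider "\<sigma> x = ctr (cl x)" | i where "i \<in> sep" "i \<noteq> cl x" "\<sigma> x = ctr i" "\<sigma> x \<noteq> ctr (cl x)"
        | "\<sigma> x \<notin> ctr ` sep" by blast
      then show ?thesis
      proof cases
        case 1
        then have "b = 0" using inj_onD[OF inj_ctr] sepD(1) True by (auto simp: b_def)
        then show ?thesis using 1 True nB \<mu>0 by (auto simp: u_def a_def)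
      next
        case 2
        then show ?thesis using True nB \<mu>0 by (auto simp: u_def a_def b_def)
      next
        case 3
        then have "b = 0" "\<sigma> x \<noteq> ctr (cl x)" using True by (auto simp: b_def)
        then show ?thesis using 3 True nB by (auto simp: u_def a_def \<mu>_def)
      qed
    qed
    then show "l x - q x - 2 * \<kappa> * (q x + l x) \<le> (l x - u x) + (\<Sum>i\<in>sep. l x - v i x)"
      unfolding eq \<mu>_def .
  qed
  also have "\<dots> = (\<Sum>x\<in>A. l x - u x) + (\<Sum>i\<in>sep. \<Sum>x\<in>A. l x - v i x)"
    unfolding sum.distrib by (subst sum.swap) simp
  also have "\<dots> \<le> ?e + (\<Sum>i\<in>sep. ?e)" using big single by (intro add_mono sum_mono) auto
  also have "\<dots> = (1 + real (card sep)) * ?e" by (simp add: algebra_simps)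
  \<comment> \<open>There are at most \<open>k + 1\<close> swaps in all, and
    \<open>k + 1 \<le> 2 * card A\<close>.\<close>
  also have "\<dots> \<le> (2 * real (card A)) * ?e"
  proof (rule mult_right_mono[OF _ e0])
    have "card sep \<le> k" using sep_sub by (metis card_lessThan card_mono finite_lessThan)
    then show "1 + real (card sep) \<le> 2 * real (card A)" using k_le_n n_pos by linarith
  qed
  also have "\<dots> = 2 * \<epsilon> * costL" using n_pos by simp
  finally show ?thesis .
qed

section \<open>The bijection and the foreign clients\<close>

lemma matching:
  obtains \<phi> where "cluster_bijection L k \<phi>" "\<And>i. i \<in> isolated \<Longrightarrow> \<phi> (ctr i) = i"
proof -
  have fin: "finite isolated" using isolated_sub finite_subset by blast
  have "card (L - ctr ` isolated) = card L - card isolated"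
    using fin ctr_L card_image[OF inj_ctr] by (subst card_Diff_subset) auto
  also have "\<dots> \<le> card ({..<k} - isolated)"
    using fin isolated_sub cardL by (simp add: card_Diff_subset)
  finally obtain g where g: "inj_on g (L - ctr ` isolated)"
    "g ` (L - ctr ` isolated) \<subseteq> {..<k} - isolated"
    using inj_on_iff_card_le[of "L - ctr ` isolated" "{..<k} - isolated"] finL by auto
  define \<phi> where "\<phi> l = (if l \<in> ctr ` isolated then the_inv_into isolated ctr l else g l)" for l
  have \<phi>: "\<phi> (ctr i) = i" if "i \<in> isolated" for i
    using that the_inv_into_f_f[OF inj_ctr that] by (simp add: \<phi>_def)
  have \<phi>g: "\<phi> l = g l" "\<phi> l \<in> {..<k} - isolated" if "l \<in> L - ctr ` isolated" for l
    using that g by (auto simp: \<phi>_def)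
  have "inj_on \<phi> L"
  proof (rule inj_onI)
    fix x y assume xy: "x \<in> L" "y \<in> L" "\<phi> x = \<phi> y"
    show "x = y"
      by (cases "x \<in> ctr ` isolated"; cases "y \<in> ctr ` isolated")
        (use xy \<phi> \<phi>g[of x] \<phi>g[of y] inj_onD[OF g(1)] in auto)
  qed
  moreover have "\<phi> ` L \<subseteq> {..<k}"
  proof
    fix i assume "i \<in> \<phi> ` L"
    then obtain l where l: "l \<in> L" "i = \<phi> l" by blast
    show "i \<in> {..<k}"
      by (cases "l \<in> ctr ` isolated") (use l \<phi> \<phi>g[of l] isolated_sub in auto)
  qed
  ultimately show ?thesis using \<phi> by (intro that[of \<phi>]) (auto simp: cluster_bijection_def)
qed

definition foreign_cost :: "nat \<Rightarrow> real" where
  "foreign_cost i = (\<Sum>x\<in>{x \<in> A - C i. \<sigma> x = ctr i}. d x (\<sigma> x))"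

text \<open>As \<open>ctr\<close> is injective, each client is charged to at most one index, so the
  foreign costs add up to at most \<open>costL\<close>.\<close>

lemma card_foreign:
  assumes "0 \<le> T"
  shows "real (card {i \<in> isolated. T < foreign_cost i}) * T \<le> costL"
proof -
  have fin: "finite isolated" using isolated_sub finite_subset by blast
  have "real (card {i \<in> isolated. T < foreign_cost i}) * T \<le> (\<Sum>i\<in>isolated. foreign_cost i)"
    by (rule card_mult_le_sum) (auto simp: fin foreign_cost_def intro!: sum_nonneg)
  also have "\<dots> \<le> (\<Sum>i\<in>isolated. \<Sum>x\<in>{x \<in> A. \<sigma> x = ctr i}. d x (\<sigma> x))"
    unfolding foreign_cost_def using finA by (intro sum_mono sum_mono2) auto
  also have "\<dots> = (\<Sum>x\<in>(\<Union>i\<in>isolated. {x \<in> A. \<sigma> x = ctr i}). d x (\<sigma> x))"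
    using fin finA inj_onD[OF inj_ctr] by (intro sum.UNION_disjoint[symmetric]) auto
  also have "\<dots> \<le> costL" unfolding costL_eq using finA by (intro sum_mono2) auto
  finally show ?thesis .
qed

text \<open>Near points lie in \<open>R\<close>, are served by \<open>ctr i\<close> and make up a
  \<open>1 - \<epsilon> / 2\<close> fraction of \<open>C i\<close>, which gives (i). A foreign
  client pays at least \<open>8/9 * r i\<close>, so the bound 2/3 allows at most
  \<open>3/4 * \<epsilon> * card (C i)\<close> of them, while \<open>R \<inter> C i\<close> has at
  least \<open>3/4 * card (C i)\<close> points; this gives (ii).\<close>

lemma well_served_isolated:
  assumes \<kappa>_eq: "\<kappa> = \<epsilon> / 2" and i: "i \<in> isolated"
    and far: "\<And>x j. \<lbrakk>j < k; j \<noteq> i; x \<in> C j\<rbrakk> \<Longrightarrow> r i \<le> d x (c i)"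
    and few: "foreign_cost i \<le> 2/3 * \<epsilon> * D" and R: "near i \<subseteq> R"
  shows "well_served \<epsilon> k C R \<sigma> i (ctr i)"
proof -
  have ik: "i < k" "i \<in> cheap" using i isolated_sub by auto
  note ri = r_pos[OF ik(1)]
  have fin: "finite (R \<inter> C i)" using finC[OF ik(1)] by auto
  have nC: "near i \<subseteq> C i" by (auto simp: near_def)
  have "near i \<subseteq> {x \<in> R \<inter> C i. \<sigma> x = ctr i}" using R nC near_ctr[OF i] by auto
  then have 1: "card (near i) \<le> card {x \<in> R \<inter> C i. \<sigma> x = ctr i}"
    using finC[OF ik(1)] by (intro card_mono) auto
  have 2: "card (near i) \<le> card (R \<inter> C i)" using R nC fin by (intro card_mono) auto
  have 3: "card (R \<inter> C i) \<le> card (C i)" using finC[OF ik(1)] by (intro card_mono) auto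
  have 4: "(1 - \<epsilon> / 2) * real (card (C i)) \<le> real (card (near i))"
    using card_near[OF ik(2)] \<kappa>_eq by simp
  have "(1 - \<epsilon>) * real (card (R \<inter> C i)) \<le> (1 - \<epsilon>) * real (card (C i))"
    using 3 eps by (intro mult_left_mono) auto
  also have "\<dots> \<le> (1 - \<epsilon> / 2) * real (card (C i))" using eps by (intro mult_right_mono) auto
  finally have i1: "(1 - \<epsilon>) * real (card (R \<inter> C i)) \<le> real (card {x \<in> R \<inter> C i. \<sigma> x = ctr i})"
    using 1 4 by linarith
  define N where "N = {x \<in> (\<Union>j\<in>{..<k} - {i}. C j). \<sigma> x = ctr i}"
  have NA: "N \<subseteq> {x \<in> A - C i. \<sigma> x = ctr i}" using CA ik Cdisj by (auto simp: N_def)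
  have "real (card N) * (8/9 * r i) \<le> foreign_cost i"
    unfolding foreign_cost_def
  proof (rule card_mult_le_sum[OF _ NA])
    fix x assume x: "x \<in> N"
    then have xA: "x \<in> A" "\<sigma> x = ctr i" using NA by auto
    obtain j where "j < k" "j \<noteq> i" "x \<in> C j" using x by (auto simp: N_def)
    then have "r i \<le> d x (c i)" using far by blast
    also have "\<dots> \<le> d x (ctr i) + d (ctr i) (c i)" using xA ctr_L[OF i] ik by (intro triangle) auto
    also have "d (ctr i) (c i) \<le> \<rho> * r i" using ctr_near[OF i] commute[of "ctr i"] by simp
    also have "\<rho> * r i \<le> 1/9 * r i" using \<rho> ri by (intro mult_right_mono) auto
    finally show "8/9 * r i \<le> d x (\<sigma> x)" using xA by simp
  qed (use finA in auto)
  also have "\<dots> \<le> 2/3 * \<epsilon> * (r i * real (card (C i)))" using few r_card[OF ik(1)] by simp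
  finally have "r i * (real (card N) * 8) \<le> r i * (6 * (\<epsilon> * real (card (C i))))"
    by (simp add: algebra_simps)
  then have "real (card N) * 4 \<le> 3 * (\<epsilon> * real (card (C i)))"
    using ri by (simp add: mult_le_cancel_left)
  moreover have "3/4 * real (card (C i)) \<le> (1 - \<epsilon> / 2) * real (card (C i))"
    using eps by (intro mult_right_mono) auto
  then have "3/4 * real (card (C i)) \<le> real (card (R \<inter> C i))" using 2 4 by linarith
  then have "\<epsilon> * (3/4 * real (card (C i))) \<le> \<epsilon> * real (card (R \<inter> C i))"
    using eps by (intro mult_left_mono) auto
  ultimately have "real (card N) \<le> \<epsilon> * real (card (R \<inter> C i))" by linarith
  with i1 show ?thesis by (simp add: well_served_def N_def)
qed

end

section \<open>Distribution-stable instances\<close>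

context local_optimum
begin

text \<open>\<open>\<kappa>\<close> and \<open>\<rho>\<close> stay free because the cost bound and
  the structural statement choose them differently.\<close>

lemma stable_local_optimum:
  assumes \<beta>: "0 < \<beta>" and dl: "\<delta> < 1 - \<kappa>" and \<kappa>: "0 < \<kappa>" and \<rho>: "0 < \<rho>" "\<rho> \<le> 1/9"
    and stab: "distribution_stable \<beta> \<delta> d A F k c C"
  shows "stable_local_optimum X d A F k c C \<epsilon> s L \<sigma> (\<beta> * opt d A F k) \<kappa> \<rho>"
proof
  show "0 < \<beta> * opt d A F k" using \<beta> opt_pos by simp
  fix i assume i: "i < k"
  obtain \<Delta> where \<Delta>: "\<Delta> \<subseteq> C i" "(1 - \<delta>) * real (card (C i)) \<le> real (card \<Delta>)"
    "\<forall>x\<in>\<Delta>. \<forall>j<k. j \<noteq> i \<longrightarrow> \<beta> * opt d A F k / real (card (C j)) \<le> d x (c j)"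
    using stab i unfolding distribution_stable_def by meson
  have "\<kappa> * real (card (C i)) < (1 - \<delta>) * real (card (C i))"
    using dl cardC[OF i] by (intro mult_strict_right_mono) auto
  then have "\<kappa> * real (card (C i)) < real (card \<Delta>)" using \<Delta>(2) by linarith
  then show "\<exists>\<Delta>\<subseteq>C i. \<kappa> * real (card (C i)) < real (card \<Delta>) \<and>
      (\<forall>x\<in>\<Delta>. \<forall>j<k. j \<noteq> i \<longrightarrow> \<beta> * opt d A F k / real (card (C j)) \<le> d x (c j))"
    using \<Delta> by blast
qed (use \<kappa> \<rho> in auto)

lemma approximation:
  assumes \<beta>: "0 < \<beta>" and dl: "\<delta> < 1 - \<epsilon>" and s: "3 / (\<epsilon>^3 * \<beta>) \<le> real s"
    and stab: "distribution_stable \<beta> \<delta> d A F k c C"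
  shows "costL \<le> (1 + 130 * \<epsilon>) * costC"
proof -
  have C0: "0 \<le> costC" using costL_le_costC costL_pos by linarith
  \<comment> \<open>For \<open>\<epsilon> > 1/20\<close> the factor
    \<open>1 + 130 * \<epsilon>\<close> already exceeds 15/2. In the third case
    \<open>costC < costL\<close> bounds the reference cost, not assumed optimal, by a multiple of
    the optimum.\<close>
  consider "costL \<le> costC" | "1/20 < \<epsilon>" | "costC < costL" "\<epsilon> \<le> 1/20" by linarith
  then show ?thesis
  proof cases
    case 1
    have "1 * costC \<le> (1 + 130 * \<epsilon>) * costC" using C0 eps by (intro mult_right_mono) auto
    then show ?thesis using 1 by linarith
  next
    case 2
    then have "15/2 * costC \<le> (1 + 130 * \<epsilon>) * costC" using C0 by (intro mult_right_mono) auto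
    then show ?thesis using costL_le_costC by linarith
  next
    case 3
    have "\<epsilon> * \<epsilon> \<le> 1/20 * (1/20)" using 3 eps by (intro mult_mono) auto
    then have \<rho>: "30 * \<epsilon>^2 \<le> 1/9" by (simp add: power2_eq_square)
    interpret S: stable_local_optimum X d A F k c C \<epsilon> s L \<sigma> "\<beta> * opt d A F k" \<epsilon> "30 * \<epsilon>^2"
      using stable_local_optimum[OF \<beta> dl _ _ \<rho> stab] eps by simp
    let ?N = "real (card ({..<k} - S.cheap))"
    \<comment> \<open>Both costs are at most 15/2 times the optimum. The 30 in \<open>\<rho>\<close>
      makes \<open>6 * ?N\<close> at most \<open>3 / (\<epsilon>^3 * \<beta>)\<close>, which pays
      for the large swap.\<close>
    have "?N * (\<epsilon> * (30 * \<epsilon>^2) * (\<beta> * opt d A F k)) \<le> 15 * opt d A F k"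
      using S.card_expensive costL_le_opt 3 by linarith
    then have "opt d A F k * (?N * 2 * (\<epsilon>^3 * \<beta>)) \<le> opt d A F k * 1"
      by (simp add: power3_eq_cube power2_eq_square algebra_simps)
    then have "?N * 2 * (\<epsilon>^3 * \<beta>) \<le> 1" using opt_pos by (simp only: mult_le_cancel_left_pos)
    then have "6 * ?N \<le> 3 / (\<epsilon>^3 * \<beta>)" using eps \<beta> by (simp add: field_simps)
    then have "6 * card ({..<k} - S.cheap) \<le> s" using s by linarith
    then have "2 * card ({..<k} - S.sep) \<le> s" using S.card_not_sep by linarith
    then have "(1 - 4 * \<epsilon>) * costL \<le> (1 + 2 * \<epsilon>) * costC"
      using S.sep_approx eps by (simp add: algebra_simps)
    also have "\<dots> \<le> ((1 - 4 * \<epsilon>) * (1 + 130 * \<epsilon>)) * costC"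
    proof (rule mult_right_mono[OF _ C0])
      have "\<epsilon> * \<epsilon> \<le> \<epsilon> * (1/20)" using 3 eps by (intro mult_left_mono) auto
      then show "1 + 2 * \<epsilon> \<le> (1 - 4 * \<epsilon>) * (1 + 130 * \<epsilon>)" using eps by (simp add: algebra_simps)
    qed
    finally have "(1 - 4 * \<epsilon>) * costL \<le> (1 - 4 * \<epsilon>) * ((1 + 130 * \<epsilon>) * costC)" by (simp add: mult.assoc)
    then show ?thesis using 3 by (simp add: mult_le_cancel_left_pos)
  qed
qed

text \<open>With \<open>\<rho>\<close> equal to \<open>\<epsilon>^2\<close>, near points lie in the
  inner ring. An index can fail only by not being isolated or by a large foreign cost, and both
  kinds are few.\<close>

lemma mostly_well_served:
  assumes \<beta>: "0 < \<beta>" and stab: "distribution_stable \<beta> 0 d A F k c C"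
  shows "\<exists>\<phi>. cluster_bijection L k \<phi> \<and>
    real (card {i. i < k \<and> (\<exists>l\<in>L. \<phi> l = i \<and>
      well_served \<epsilon> k C (inner_ring d (\<epsilon>^2) \<beta> d A F k c C i) \<sigma> i l)})
    \<ge> real k - 36 * (costC / opt d A F k) * (1 / (\<epsilon>^3 * \<beta>))"
proof -
  have "\<epsilon> * \<epsilon> \<le> 1/3 * (1/3)" using eps by (intro mult_mono) auto
  then have \<rho>: "\<epsilon>^2 \<le> 1/9" by (simp add: power2_eq_square)
  interpret S: stable_local_optimum X d A F k c C \<epsilon> s L \<sigma> "\<beta> * opt d A F k" "\<epsilon> / 2" "\<epsilon>^2"
    using stable_local_optimum[OF \<beta> _ _ _ \<rho> stab, of "\<epsilon> / 2"] eps by simp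
  let ?D = "\<beta> * opt d A F k"
  define E where "E = {i \<in> S.isolated. 2/3 * \<epsilon> * ?D < S.foreign_cost i}"
  have finI: "finite S.isolated" using S.isolated_sub finite_subset by blast
  obtain \<phi> where \<phi>: "cluster_bijection L k \<phi>" "\<And>i. i \<in> S.isolated \<Longrightarrow> \<phi> (S.ctr i) = i"
    using S.matching by blast
  define G where "G = {i. i < k \<and> (\<exists>l\<in>L. \<phi> l = i \<and>
      well_served \<epsilon> k C (inner_ring d (\<epsilon>^2) \<beta> d A F k c C i) \<sigma> i l)}"
  \<comment> \<open>For \<delta> = 0 the stable part has full cardinality, so it is the whole
    cluster.\<close>
  have all_far: "S.r i \<le> d x (c i)" if "i < k" "j < k" "j \<noteq> i" "x \<in> C j" for i j x
  proof -
    obtain \<Delta> where \<Delta>: "\<Delta> \<subseteq> C j" "real (card (C j)) \<le> real (card \<Delta>)"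
      "\<forall>x\<in>\<Delta>. \<forall>i<k. i \<noteq> j \<longrightarrow> ?D / real (card (C i)) \<le> d x (c i)"
      using stab \<open>j < k\<close> unfolding distribution_stable_def by (metis diff_zero mult_1)
    have "\<Delta> = C j" using \<Delta> finC[OF \<open>j < k\<close>] by (intro card_seteq) auto
    then show ?thesis using \<Delta> that by (auto simp: S.r_def)
  qed
  have "S.isolated - E \<subseteq> G"
  proof
    fix i assume i: "i \<in> S.isolated - E"
    then have ik: "i \<in> S.isolated" "i < k" using S.isolated_sub by auto
    have "well_served \<epsilon> k C (inner_ring d (\<epsilon>^2) \<beta> d A F k c C i) \<sigma> i (S.ctr i)"
    proof (rule S.well_served_isolated[OF refl ik(1)])
      show "S.foreign_cost i \<le> 2/3 * \<epsilon> * ?D" using i by (auto simp: E_def)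
      show "S.near i \<subseteq> inner_ring d (\<epsilon>^2) \<beta> d A F k c C i"
      proof
        fix x assume "x \<in> S.near i"
        then have "x \<in> C i" "d x (c i) + d x (\<sigma> x) < \<epsilon>^2 * S.r i" by (auto simp: S.near_def)
        moreover from this have "d x (c i) \<le> \<epsilon>^2 * S.r i" using nonneg[of x "\<sigma> x"] by linarith
        ultimately show "x \<in> inner_ring d (\<epsilon>^2) \<beta> d A F k c C i"
          using CA[OF ik(2)] by (auto simp: inner_ring_def S.r_def mult.assoc)
      qed
    qed (use all_far ik in auto)
    then show "i \<in> G" using ik \<phi> S.ctr_L by (auto simp: G_def)
  qed
  then have "card (S.isolated - E) \<le> card G" by (intro card_mono) (auto simp: G_def)
  moreover have "card S.isolated - card E \<le> card (S.isolated - E)"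
    by (intro diff_card_le_card_Diff) (use finI in \<open>simp add: E_def\<close>)
  moreover have "k - card S.isolated = card ({..<k} - S.isolated)"
    using finI S.isolated_sub by (simp add: card_Diff_subset)
  ultimately have "k \<le> card G + 2 * card ({..<k} - S.cheap) + card E"
    using S.card_not_isolated by linarith
  then have kG: "real k - real (card G) \<le> 2 * real (card ({..<k} - S.cheap)) + real (card E)"
    by linarith
  define n where "n = real (card ({..<k} - S.cheap))"
  define m where "m = real (card E)"
  have a: "n * (\<epsilon> / 2 * \<epsilon>^2 * ?D) \<le> 17/2 * costC"
    using S.card_expensive costL_le_costC unfolding n_def by linarith
  have "m * (2/3 * \<epsilon> * ?D) \<le> costL"
    unfolding m_def E_def using eps S.D by (intro S.card_foreign) simp
  also have "\<dots> \<le> 15/2 * costC" by (rule costL_le_costC)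
  finally have b: "\<epsilon>^2 * (m * (2/3 * \<epsilon> * ?D)) \<le> \<epsilon>^2 * (15/2 * costC)"
    by (intro mult_left_mono) auto
  have C0: "0 \<le> costC" using costL_le_costC costL_pos by linarith
  have "\<epsilon>^2 * (15/2 * costC) \<le> 1/9 * (15/2 * costC)" using \<rho> C0 by (intro mult_right_mono) auto
  \<comment> \<open>The contributions are 34 from \<open>2 * n\<close> and, using
    \<open>\<epsilon>^2 \<le> 1/9\<close>, 5/4 from \<open>m\<close>; 36 covers both.\<close>
  with a b have "(2 * n + m) * (\<epsilon>^3 * ?D) \<le> 36 * costC"
    using C0 by (simp add: power3_eq_cube power2_eq_square algebra_simps)
  then have "2 * n + m \<le> 36 * costC / (\<epsilon>^3 * ?D)"
    using eps S.D by (simp add: pos_le_divide_eq)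
  also have "\<dots> = 36 * (costC / opt d A F k) * (1 / (\<epsilon>^3 * \<beta>))" by simp
  finally have "real k - 36 * (costC / opt d A F k) * (1 / (\<epsilon>^3 * \<beta>)) \<le> real (card G)"
    using kG unfolding n_def m_def by linarith
  then show ?thesis using \<phi>(1) unfolding G_def by blast
qed

end

lemma local_search_output_feasible:
  assumes "local_search_output cost A F k s \<epsilon> L"
  shows "feasible F k L"
proof -
  obtain S0 where "feasible F k S0" "(ls_step cost A F k s \<epsilon>)\<^sup>*\<^sup>* S0 L"
    using assms by (auto simp: local_search_output_def)
  from this(2,1) show ?thesis
    by (induction rule: rtranclp_induct) (auto simp: ls_step_def)
qed

text \<open>The constants and the size function are chosen before the instance. \<open>max 1\<close>
  absorbs rounding when \<open>1 / (\<epsilon>^2 * \<beta>)\<close> is small. The cost ratio in the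
  last bound appears because \<open>C\<close> need not be optimal.\<close>

theorem theorem1:
  shows "\<exists>(\<eta>::real) (M1::real) (M2::real) (sz :: real \<Rightarrow> real \<Rightarrow> nat).
    (\<forall>\<epsilon> \<beta>. 0 < \<epsilon> \<and> \<epsilon> < 1/3 \<and> 0 < \<beta> \<longrightarrow>
       \<bar>real (sz \<epsilon> \<beta>) - 4 / (\<epsilon>^3 * \<beta>)\<bar> \<le> M1 * max 1 (1 / (\<epsilon>^2 * \<beta>))) \<and>
    (\<forall>(X::'a set) d A F k c C (p::real) \<beta> \<delta> \<epsilon> L.
       Metric_space X d \<and> A \<subseteq> X \<and> F \<subseteq> X \<and> finite A \<and>
       0 < p \<and> 0 < \<beta> \<and> 0 \<le> \<delta> \<and> \<delta> \<le> 1 \<and> 0 < \<epsilon> \<and> \<epsilon> < min (1 - \<delta>) (1/3) \<and>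
       (\<forall>i<k. c i \<in> F) \<and> induced_clustering d A k c C \<and> (\<forall>i<k. C i \<noteq> {}) \<and>
       distribution_stable \<beta> \<delta> d A F k c C \<and>
       local_search_output d A F k (sz \<epsilon> \<beta>) \<epsilon> L \<longrightarrow>
         sol_cost d A L \<le> (1 + \<eta> * \<epsilon>) * clustering_cost d k c C \<and>
         (\<delta> = 0 \<longrightarrow> (\<forall>\<sigma>. induced_assignment d A L \<sigma> \<longrightarrow>
            (\<exists>\<phi>. cluster_bijection L k \<phi> \<and>
               real (card {i. i < k \<and> (\<exists>l\<in>L. \<phi> l = i \<and>
                  well_served \<epsilon> k C (inner_ring d (\<epsilon>^2) \<beta> d A F k c C i) \<sigma> i l)})
               \<ge> real k - M2 * (clustering_cost d k c C / opt d A F k) * (1 / (\<epsilon>^3 * \<beta>))))))"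
proof -
  \<comment> \<open>The summand 2 keeps single swaps available however small
    \<open>4 / (\<epsilon>^3 * \<beta>)\<close> is.\<close>
  define sz :: "real \<Rightarrow> real \<Rightarrow> nat" where "sz \<epsilon> \<beta> = nat \<lceil>4 / (\<epsilon>^3 * \<beta>)\<rceil> + 2" for \<epsilon> \<beta>
  have sz: "4 / (\<epsilon>^3 * \<beta>) + 2 \<le> real (sz \<epsilon> \<beta>)" "real (sz \<epsilon> \<beta>) \<le> 4 / (\<epsilon>^3 * \<beta>) + 3"
    if "0 < \<epsilon>" "0 < \<beta>" for \<epsilon> \<beta>
  proof -
    have "0 < 4 / (\<epsilon>^3 * \<beta>)" using that by simp
    then show "4 / (\<epsilon>^3 * \<beta>) + 2 \<le> real (sz \<epsilon> \<beta>)" "real (sz \<epsilon> \<beta>) \<le> 4 / (\<epsilon>^3 * \<beta>) + 3"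
      unfolding sz_def by linarith+
  qed
  show ?thesis
  proof (rule exI[of _ 130], rule exI[of _ 3], rule exI[of _ 36], rule exI[of _ sz],
      intro conjI allI impI, goal_cases)
    case (1 \<epsilon> \<beta>)
    then show ?case using sz[of \<epsilon> \<beta>] max.cobounded1[of 1 "1 / (\<epsilon>^2 * \<beta>)"] by linarith
  next
    case (2 X d A F k c C p \<beta> \<delta> \<epsilon> L)
    then have L: "feasible F k L" using local_search_output_feasible by blast
    \<comment> \<open>The cost bound mentions no assignment, so any one will do.\<close>
    then obtain \<sigma> where \<sigma>: "induced_assignment d A L \<sigma>"
      using induced_assignment_exists by (metis feasible_def)
    have s: "4 / (\<epsilon>^3 * \<beta>) + 2 \<le> real (sz \<epsilon> \<beta>)" "0 < 1 / (\<epsilon>^3 * \<beta>)" using sz 2 by auto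
    interpret local_optimum X d A F k c C \<epsilon> "sz \<epsilon> \<beta>" L \<sigma>
      using 2 L \<sigma> by (auto simp: local_optimum_def local_optimum_axioms_def
          local_search_output_def sz_def)
    show ?case using approximation[of \<beta> \<delta>] 2 s by auto
  next
    case (3 X d A F k c C p \<beta> \<delta> \<epsilon> L \<sigma>)
    then have L: "feasible F k L" using local_search_output_feasible by blast
    interpret local_optimum X d A F k c C \<epsilon> "sz \<epsilon> \<beta>" L \<sigma>
      using 3 L by (auto simp: local_optimum_def local_optimum_axioms_def
          local_search_output_def sz_def)
    show ?case using mostly_well_served[of \<beta>] 3 by auto
  qed
qed

end
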